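(* Let $G$ be an RD-group for the length function $L$, and let $\beta$ be a length-preserving automorphism of $G$ such that every orbit of $\beta$ in $G$ is either infinite or a singleton. Let $\alpha$ be the automorphism of the reduced group $C^*$-algebra $C^*_r(G)$ induced by $\beta$. Then $\alpha$ is $E$-strictly weak mixing, where $E$ is a conditional expectation of $C^*_r(G)$ onto the fixed-point subalgebra $C^*_r(G)^\alpha=\{x\in C^*_r(G):\alpha(x)=x\}$. That is, there is a conditional expectation $E$ of $C^*_r(G)$ onto $C^*_r(G)^\alpha$ such that $$\lim_{n\to\infty}\frac1n\sum_{k=0}^{n-1}\big|\varphi(\alpha^k(x))-\varphi(E(x))\big|=0$$ for every $x\in C^*_r(G)$ and every state $\varphi$ on $C^*_r(G)$.
   Context: A length function on a discrete group $G$ with identity $e$ is a map $L:G\to[0,\infty)$ with $L(e)=0$, $L(g^{-1})=L(g)$ and $L(gh)\le L(g)+L(h)$ for all $g,h\in G$. The discrete group $G$ is an RD-group (it has the rapid decay property) for the length function $L$ if there are constants $C,s>0$ such that for every finitely supported $f:G\to\mathbb{C}$, $$\Big\|\sum_{g\in G}f(g)\lambda_g\Big\|\le C\Big(\sum_{g\in G}|f(g)|^2(1+L(g))^{2s}\Big)^{1/2},$$ where $\lambda$ is the left regular representation of $G$ on $\ell^2(G)$ and the norm on the left is the operator norm. $C^*_r(G)$ is the $C^*$-algebra generated by $\{\lambda_g:g\in G\}$. An automorphism $\beta$ of $G$ is length-preserving if $L(\beta(g))=L(g)$ for all $g\in G$. It induces the automorphism $\alpha$ of $C^*_r(G)$ determined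 by $\alpha(\lambda_g)=\lambda_{\beta(g)}$. The orbit of $g\in G$ under $\beta$ is $\{\beta^k(g):k\in\mathbb{Z}\}$. A conditional expectation of a unital $C^*$-algebra $\mathfrak{A}$ onto a $C^*$-subalgebra $\mathfrak{B}$ with the same identity is a norm-one projection of $\mathfrak{A}$ onto $\mathfrak{B}$. *)

theory Defs
  imports "HOL-Analysis.Analysis" "HOL-Library.Nonpos_Ints"
begin

section \<open>Complex scalars\<close>

class complex_normed_vector = real_normed_vector +
  fixes scaleC :: "complex \<Rightarrow> 'a \<Rightarrow> 'a"  (infixr \<open>*\<^sub>C\<close> 75)
  assumes scaleC_add_right: "c *\<^sub>C (x + y) = c *\<^sub>C x + c *\<^sub>C y"
    and scaleC_add_left: "(c + d) *\<^sub>C x = c *\<^sub>C x + d *\<^sub>C x"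
    and scaleC_scaleC: "c *\<^sub>C d *\<^sub>C x = (c * d) *\<^sub>C x"
    and scaleR_scaleC: "r *\<^sub>R x = complex_of_real r *\<^sub>C x"
    and norm_scaleC: "norm (c *\<^sub>C x) = cmod c * norm x"

instantiation complex :: complex_normed_vector
begin

definition scaleC_complex :: "complex \<Rightarrow> complex \<Rightarrow> complex" where
  "scaleC_complex c x = c * x"

instance
  by standard (simp_all add: scaleC_complex_def algebra_simps norm_mult scaleR_conv_of_real)

end

lemma bounded_linear_scaleC: "bounded_linear (\<lambda>x :: 'a :: complex_normed_vector. c *\<^sub>C x)"
proof (rule bounded_linear_intro)
  fix r and x y :: 'a
  show "c *\<^sub>C (x + y) = c *\<^sub>C x + c *\<^sub>C y" by (rule scaleC_add_right)
  show "c *\<^sub>C (r *\<^sub>R x) = r *\<^sub>R (c *\<^sub>C x)"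
    by (simp add: scaleR_scaleC scaleC_scaleC mult.commute)
  show "norm (c *\<^sub>C x) \<le> norm x * cmod c" by (simp add: norm_scaleC mult.commute)
qed

instantiation blinfun :: (real_normed_vector, complex_normed_vector) complex_normed_vector
begin

lift_definition scaleC_blinfun :: "complex \<Rightarrow> 'a \<Rightarrow>\<^sub>L 'b \<Rightarrow> 'a \<Rightarrow>\<^sub>L 'b"
  is "\<lambda>c f x. c *\<^sub>C f x"
  by (rule bounded_linear_compose[OF bounded_linear_scaleC])

instance
proof
  fix c d :: complex and r :: real and f g :: "'a \<Rightarrow>\<^sub>L 'b"
  show "c *\<^sub>C (f + g) = c *\<^sub>C f + c *\<^sub>C g"
    by transfer (simp add: scaleC_add_right)
  show "(c + d) *\<^sub>C f = c *\<^sub>C f + d *\<^sub>C f"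
    by transfer (simp add: scaleC_add_left)
  show "c *\<^sub>C d *\<^sub>C f = (c * d) *\<^sub>C f"
    by transfer (simp add: scaleC_scaleC)
  show "r *\<^sub>R f = complex_of_real r *\<^sub>C f"
    by transfer (simp add: scaleR_scaleC)
  show "norm (c *\<^sub>C f) = cmod c * norm f"
  proof (rule antisym)
    show "norm (c *\<^sub>C f) \<le> cmod c * norm f"
    proof (rule norm_blinfun_bound)
      fix x
      show "norm (blinfun_apply (c *\<^sub>C f) x) \<le> cmod c * norm f * norm x"
        using mult_left_mono[OF norm_blinfun[of f x], of "cmod c"]
        by (simp add: scaleC_blinfun.rep_eq norm_scaleC mult.assoc)
    qed simp
    show "cmod c * norm f \<le> norm (c *\<^sub>C f)"
    proof (cases "c = 0")
      case False
      have "norm f \<le> norm (c *\<^sub>C f) / cmod c"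
      proof (rule norm_blinfun_bound)
        fix x
        show "norm (blinfun_apply f x) \<le> norm (c *\<^sub>C f) / cmod c * norm x"
          using norm_blinfun[of "c *\<^sub>C f" x] False
          by (simp add: scaleC_blinfun.rep_eq norm_scaleC field_simps)
      qed simp
      then show ?thesis using False by (simp add: field_simps)
    qed simp
  qed
qed

end

definition complex_linear_on ::
    "'a::complex_normed_vector set \<Rightarrow> ('a \<Rightarrow> 'b::complex_normed_vector) \<Rightarrow> bool" where
  "complex_linear_on A f \<longleftrightarrow>
     (\<forall>x\<in>A. \<forall>y\<in>A. f (x + y) = f x + f y) \<and> (\<forall>c. \<forall>x\<in>A. f (c *\<^sub>C x) = c *\<^sub>C f x)"

text \<open>\<open>f\<close>, defined on the linear subspace \<open>A\<close>, is bounded there and its operator norm is \<open>K\<close>,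
  the least admissible bound.\<close>

definition has_norm_on ::
    "'a::complex_normed_vector set \<Rightarrow> ('a \<Rightarrow> 'b::complex_normed_vector) \<Rightarrow> real \<Rightarrow> bool" where
  "has_norm_on A f K \<longleftrightarrow>
     0 \<le> K \<and> (\<forall>x\<in>A. norm (f x) \<le> K * norm x) \<and>
     (\<forall>K'\<ge>0. (\<forall>x\<in>A. norm (f x) \<le> K' * norm x) \<longrightarrow> K \<le> K')"


section \<open>Square-summable functions\<close>

typedef 'a ell2 = "{f :: 'a \<Rightarrow> complex. (\<lambda>g. (cmod (f g))\<^sup>2) summable_on UNIV}"
  by (rule exI[of _ "\<lambda>_. 0"]) simp

setup_lifting type_definition_ell2

lemma ell2_abs_summable_product:
  assumes "(\<lambda>g. (cmod (f g))\<^sup>2) summable_on UNIV" "(\<lambda>g. (cmod (h g))\<^sup>2) summable_on UNIV"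
  shows "(\<lambda>g. norm (f g * cnj (h g))) summable_on UNIV"
proof (rule abs_summable_product)
  show "(\<lambda>g. norm (f g * f g)) summable_on UNIV"
    using assms(1) by (simp add: norm_mult power2_eq_square)
  show "(\<lambda>g. norm (cnj (h g) * cnj (h g))) summable_on UNIV"
    using assms(2) by (simp add: norm_mult power2_eq_square)
qed

lemma ell2_summable_add:
  assumes "(\<lambda>g. (cmod (f g))\<^sup>2) summable_on UNIV" "(\<lambda>g. (cmod (h g))\<^sup>2) summable_on UNIV"
  shows "(\<lambda>g. (cmod (f g + h g))\<^sup>2) summable_on UNIV"
proof (rule summable_on_comparison_test)
  show "(\<lambda>g. 2 * (cmod (f g))\<^sup>2 + 2 * (cmod (h g))\<^sup>2) summable_on UNIV"
    using assms by (intro summable_on_add summable_on_cmult_right)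
  fix g
  have "(cmod (f g + h g))\<^sup>2 \<le> (cmod (f g) + cmod (h g))\<^sup>2"
    by (intro power_mono norm_triangle_ineq norm_ge_zero)
  also have "\<dots> \<le> 2 * (cmod (f g))\<^sup>2 + 2 * (cmod (h g))\<^sup>2"
    using sum_squares_bound[of "cmod (f g)" "cmod (h g)"] by (simp add: power2_sum)
  finally show "(cmod (f g + h g))\<^sup>2 \<le> 2 * (cmod (f g))\<^sup>2 + 2 * (cmod (h g))\<^sup>2" .
qed simp

lemma ell2_summable_scale:
  assumes "(\<lambda>g. (cmod (f g))\<^sup>2) summable_on UNIV"
  shows "(\<lambda>g. (cmod (c * f g))\<^sup>2) summable_on UNIV"
  using assms by (simp add: norm_mult power_mult_distrib summable_on_cmult_right)

lift_definition cinner :: "'a ell2 \<Rightarrow> 'a ell2 \<Rightarrow> complex" is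
  "\<lambda>f h. \<Sum>\<^sub>\<infinity>g. f g * cnj (h g)" .

instantiation ell2 :: (type) real_inner
begin

lift_definition zero_ell2 :: "'a ell2" is "\<lambda>_. 0" by simp

lift_definition plus_ell2 :: "'a ell2 \<Rightarrow> 'a ell2 \<Rightarrow> 'a ell2" is "\<lambda>f h g. f g + h g"
  by (rule ell2_summable_add)

lift_definition uminus_ell2 :: "'a ell2 \<Rightarrow> 'a ell2" is "\<lambda>f g. - f g" by simp

lift_definition minus_ell2 :: "'a ell2 \<Rightarrow> 'a ell2 \<Rightarrow> 'a ell2" is "\<lambda>f h g. f g - h g"
proof -
  fix f h :: "'a \<Rightarrow> complex"
  assume "(\<lambda>g. (cmod (f g))\<^sup>2) summable_on UNIV" "(\<lambda>g. (cmod (h g))\<^sup>2) summable_on UNIV"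
  then show "(\<lambda>g. (cmod (f g - h g))\<^sup>2) summable_on UNIV"
    using ell2_summable_add[of f "\<lambda>g. - h g"] by simp
qed

lift_definition scaleR_ell2 :: "real \<Rightarrow> 'a ell2 \<Rightarrow> 'a ell2" is
  "\<lambda>r f g. complex_of_real r * f g"
  by (rule ell2_summable_scale)

definition inner_ell2 :: "'a ell2 \<Rightarrow> 'a ell2 \<Rightarrow> real" where
  "inner_ell2 x y = Re (cinner x y)"

definition norm_ell2 :: "'a ell2 \<Rightarrow> real" where
  "norm_ell2 x = sqrt (inner x x)"

definition dist_ell2 :: "'a ell2 \<Rightarrow> 'a ell2 \<Rightarrow> real" where
  "dist_ell2 x y = norm (x - y)"

definition sgn_ell2 :: "'a ell2 \<Rightarrow> 'a ell2" where
  "sgn_ell2 x = inverse (norm x) *\<^sub>R x"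

definition uniformity_ell2 :: "('a ell2 \<times> 'a ell2) filter" where
  "uniformity_ell2 = (INF e\<in>{0<..}. principal {(x, y). dist x y < e})"

definition open_ell2 :: "'a ell2 set \<Rightarrow> bool" where
  "open_ell2 U \<longleftrightarrow> (\<forall>x\<in>U. \<forall>\<^sub>F (x', y) in uniformity. x' = x \<longrightarrow> y \<in> U)"

instance
proof
  fix a b :: real and x y z :: "'a ell2"
  show "x + y + z = x + (y + z)" by transfer (simp add: add.assoc)
  show "x + y = y + x" by transfer (simp add: add.commute)
  show "0 + x = x" by transfer simp
  show "- x + x = 0" by transfer simp
  show "x - y = x + - y" by transfer simp
  show "a *\<^sub>R (x + y) = a *\<^sub>R x + a *\<^sub>R y" by transfer (simp add: algebra_simps)
  show "(a + b) *\<^sub>R x = a *\<^sub>R x + b *\<^sub>R x" by transfer (simp add: algebra_simps)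
  show "a *\<^sub>R b *\<^sub>R x = (a * b) *\<^sub>R x" by transfer (simp add: algebra_simps)
  show "1 *\<^sub>R x = x" by transfer simp
  show "dist x y = norm (x - y)" by (rule dist_ell2_def)
  show "sgn x = inverse (norm x) *\<^sub>R x" by (rule sgn_ell2_def)
  show "uniformity = (INF e\<in>{0<..}. principal {(x :: 'a ell2, y). dist x y < e})"
    by (rule uniformity_ell2_def)
  show "open U \<longleftrightarrow> (\<forall>x\<in>U. \<forall>\<^sub>F (x', y) in uniformity. x' = x \<longrightarrow> y \<in> U)" for U :: "'a ell2 set"
    by (rule open_ell2_def)
  show "norm x = sqrt (inner x x)" by (rule norm_ell2_def)
  have "cinner x y = cnj (cinner y x)"
    by transfer (simp flip: infsum_cnj add: mult.commute)
  then show "inner x y = inner y x" by (simp add: inner_ell2_def)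
  have "cinner (x + y) z = cinner x z + cinner y z"
    by transfer
      (simp add: distrib_right infsum_add abs_summable_summable[OF ell2_abs_summable_product])
  then show "inner (x + y) z = inner x z + inner y z" by (simp add: inner_ell2_def)
  have "cinner (a *\<^sub>R x) y = complex_of_real a * cinner x y"
    by transfer (simp add: mult.assoc infsum_cmult_right')
  then show "inner (a *\<^sub>R x) y = a * inner x y" by (simp add: inner_ell2_def)
  have self: "inner x x = (\<Sum>\<^sub>\<infinity>g. (cmod (Rep_ell2 x g))\<^sup>2)"
  proof -
    have "(\<lambda>g. (cmod (Rep_ell2 x g))\<^sup>2) summable_on UNIV"
      using Rep_ell2[of x] by simp
    from abs_summable_summable[OF ell2_abs_summable_product[OF this this]]
    have "(\<lambda>g. Rep_ell2 x g * cnj (Rep_ell2 x g)) summable_on UNIV" .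
    from infsum_Re[OF this] show ?thesis
      by (simp add: inner_ell2_def cinner.rep_eq complex_mult_cnj cmod_power2)
  qed
  show "0 \<le> inner x x" unfolding self by (rule infsum_nonneg) simp
  show "inner x x = 0 \<longleftrightarrow> x = 0"
  proof
    assume "inner x x = 0"
    moreover have "(\<lambda>g. (cmod (Rep_ell2 x g))\<^sup>2) summable_on UNIV"
      using Rep_ell2[of x] by simp
    ultimately have "(cmod (Rep_ell2 x g))\<^sup>2 = 0" for g
      unfolding self by (intro nonneg_infsum_le_0D[where A = UNIV]) auto
    then show "x = 0" by transfer (simp add: fun_eq_iff)
  qed (unfold self, simp add: zero_ell2.rep_eq)
qed

end

instantiation ell2 :: (type) complex_normed_vector
begin

lift_definition scaleC_ell2 :: "complex \<Rightarrow> 'a ell2 \<Rightarrow> 'a ell2" is "\<lambda>c f g. c * f g"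
  by (rule ell2_summable_scale)

instance
proof
  fix c d :: complex and r :: real and x y :: "'a ell2"
  show "c *\<^sub>C (x + y) = c *\<^sub>C x + c *\<^sub>C y" by transfer (simp add: algebra_simps)
  show "(c + d) *\<^sub>C x = c *\<^sub>C x + d *\<^sub>C x" by transfer (simp add: algebra_simps)
  show "c *\<^sub>C d *\<^sub>C x = (c * d) *\<^sub>C x" by transfer (simp add: algebra_simps)
  show "r *\<^sub>R x = complex_of_real r *\<^sub>C x" by transfer simp
  have "cinner (c *\<^sub>C x) (c *\<^sub>C x) = complex_of_real ((cmod c)\<^sup>2) * cinner x x"
  proof -
    have "(c * u) * cnj (c * u) = complex_of_real ((cmod c)\<^sup>2) * (u * cnj u)" for u
      by (simp add: complex_norm_square mult.commute mult.left_commute del: of_real_power)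
    then show ?thesis
      by transfer (simp only: infsum_cmult_right')
  qed
  then show "norm (c *\<^sub>C x) = cmod c * norm x"
    by (simp add: norm_eq_sqrt_inner inner_ell2_def real_sqrt_mult del: of_real_power)
qed

end


section \<open>Operator algebras on square-summable functions\<close>

text \<open>The type \<open>'a op\<close> consists of the bounded real-linear operators on \<open>'a ell2\<close>, with the operator
  norm. All C*-algebras are concrete, not necessarily unital algebras of such operators, and complex
  linearity of their elements is part of \<open>cstar_algebra\<close>. The adjoint is used as a relation; it is
  unique whenever it exists. Maps on a C*-algebra \<open>A\<close> are total functions of which only the values
  on \<open>A\<close> matter.\<close>

type_synonym 'a op = "'a ell2 \<Rightarrow>\<^sub>L 'a ell2"

definition is_adjoint :: "'a op \<Rightarrow> 'a op \<Rightarrow> bool" where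
  "is_adjoint S T \<longleftrightarrow> (\<forall>x y. cinner (blinfun_apply S x) y = cinner x (blinfun_apply T y))"

definition cstar_algebra :: "'a op set \<Rightarrow> bool" where
  "cstar_algebra A \<longleftrightarrow>
     (\<forall>S\<in>A. complex_linear_on UNIV (blinfun_apply S)) \<and>
     0 \<in> A \<and>
     (\<forall>S\<in>A. \<forall>T\<in>A. S + T \<in> A) \<and>
     (\<forall>c. \<forall>S\<in>A. c *\<^sub>C S \<in> A) \<and>
     (\<forall>S\<in>A. \<forall>T\<in>A. S o\<^sub>L T \<in> A) \<and>
     (\<forall>S\<in>A. \<exists>T\<in>A. is_adjoint S T) \<and>
     closed A"

definition star_automorphism :: "'a op set \<Rightarrow> ('a op \<Rightarrow> 'a op) \<Rightarrow> bool" where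
  "star_automorphism A \<alpha> \<longleftrightarrow>
     bij_betw \<alpha> A A \<and>
     complex_linear_on A \<alpha> \<and>
     (\<forall>S\<in>A. \<forall>T\<in>A. \<alpha> (S o\<^sub>L T) = \<alpha> S o\<^sub>L \<alpha> T) \<and>
     (\<forall>S\<in>A. \<forall>T\<in>A. is_adjoint S T \<longrightarrow> is_adjoint (\<alpha> S) (\<alpha> T))"

definition fixed_points :: "'a op set \<Rightarrow> ('a op \<Rightarrow> 'a op) \<Rightarrow> 'a op set" where
  "fixed_points A \<alpha> = {x \<in> A. \<alpha> x = x}"

text \<open>Positivity is tested on the elements \<open>S\<^sup>* S\<close>.\<close>

definition state_on :: "'a op set \<Rightarrow> ('a op \<Rightarrow> complex) \<Rightarrow> bool" where
  "state_on A \<phi> \<longleftrightarrow>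
     complex_linear_on A \<phi> \<and>
     (\<forall>S\<in>A. \<forall>T\<in>A. is_adjoint S T \<longrightarrow> \<phi> (T o\<^sub>L S) \<in> \<real>\<^sub>\<ge>\<^sub>0) \<and>
     has_norm_on A \<phi> 1"

definition conditional_expectation :: "'a op set \<Rightarrow> 'a op set \<Rightarrow> ('a op \<Rightarrow> 'a op) \<Rightarrow> bool" where
  "conditional_expectation A B E \<longleftrightarrow>
     cstar_algebra A \<and> cstar_algebra B \<and> B \<subseteq> A \<and> id_blinfun \<in> B \<and>
     complex_linear_on A E \<and> E ` A = B \<and> (\<forall>x\<in>A. E (E x) = E x) \<and> has_norm_on A E 1"

definition strictly_weak_mixing ::
    "'a op set \<Rightarrow> ('a op \<Rightarrow> 'a op) \<Rightarrow> ('a op \<Rightarrow> 'a op) \<Rightarrow> bool" where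
  "strictly_weak_mixing A E \<alpha> \<longleftrightarrow>
     (\<forall>x\<in>A. \<forall>\<phi>. state_on A \<phi> \<longrightarrow>
        (\<lambda>n. (1 / real n) * (\<Sum>k<n. cmod (\<phi> ((\<alpha> ^^ k) x) - \<phi> (E x)))) \<longlonglongrightarrow> 0)"


section \<open>Discrete groups\<close>

text \<open>The discrete group is a type of class \<open>group_add\<close>: it is written additively but is not assumed
  to be commutative.\<close>

lemma summable_left_shift:
  fixes g :: "'g::group_add"
  assumes "(\<lambda>h. (cmod (f h))\<^sup>2) summable_on UNIV"
  shows "(\<lambda>h. (cmod (f (- g + h)))\<^sup>2) summable_on UNIV"
proof -
  have "bij_betw (\<lambda>h. - g + h) UNIV UNIV"
    by (rule bij_betwI[of _ _ _ "\<lambda>h. g + h"]) (auto simp flip: add.assoc)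
  from summable_on_reindex_bij_betw[OF this, of "\<lambda>h. (cmod (f h))\<^sup>2"] assms
  show ?thesis by simp
qed

lift_definition left_shift :: "'g::group_add \<Rightarrow> 'g ell2 \<Rightarrow> 'g ell2" is "\<lambda>g f h. f (- g + h)"
  by (rule summable_left_shift)

lemma cinner_left_shift: "cinner (left_shift g x) (left_shift g y) = cinner x y"
proof -
  have "bij_betw (\<lambda>h. - g + h) UNIV UNIV"
    by (rule bij_betwI[of _ _ _ "\<lambda>h. g + h"]) (auto simp flip: add.assoc)
  from infsum_reindex_bij_betw[OF this, of "\<lambda>h. Rep_ell2 x h * cnj (Rep_ell2 y h)"]
  show ?thesis by (simp add: cinner.rep_eq left_shift.rep_eq)
qed

lemma bounded_linear_left_shift: "bounded_linear (left_shift g)"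
proof (rule bounded_linear_intro)
  fix r and x y :: "'a ell2"
  show "left_shift g (x + y) = left_shift g x + left_shift g y" by transfer simp
  show "left_shift g (r *\<^sub>R x) = r *\<^sub>R left_shift g x" by transfer simp
  show "norm (left_shift g x) \<le> norm x * 1"
    by (simp add: norm_eq_sqrt_inner inner_ell2_def cinner_left_shift)
qed

lift_definition left_regular :: "'g::group_add \<Rightarrow> 'g op" is left_shift
  by (rule bounded_linear_left_shift)

definition reduced_group_cstar :: "'g::group_add op set" where
  "reduced_group_cstar = \<Inter>{A. cstar_algebra A \<and> range left_regular \<subseteq> A}"

definition length_function :: "('g::group_add \<Rightarrow> real) \<Rightarrow> bool" where
  "length_function L \<longleftrightarrow>
     (\<forall>g. 0 \<le> L g) \<and> L 0 = 0 \<and> (\<forall>g. L (- g) = L g) \<and> (\<forall>g h. L (g + h) \<le> L g + L h)"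

definition RD_group :: "('g::group_add \<Rightarrow> real) \<Rightarrow> bool" where
  "RD_group L \<longleftrightarrow>
     length_function L \<and>
     (\<exists>C>0. \<exists>s>0. \<forall>f :: 'g \<Rightarrow> complex. finite {g. f g \<noteq> 0} \<longrightarrow>
        norm (\<Sum>g | f g \<noteq> 0. f g *\<^sub>C left_regular g)
          \<le> C * sqrt (\<Sum>g | f g \<noteq> 0. (cmod (f g))\<^sup>2 * (1 + L g) powr (2 * s)))"

definition group_automorphism :: "('g::group_add \<Rightarrow> 'g) \<Rightarrow> bool" where
  "group_automorphism \<beta> \<longleftrightarrow> bij \<beta> \<and> (\<forall>g h. \<beta> (g + h) = \<beta> g + \<beta> h)"

text \<open>The two-sided orbit; \<open>inv \<beta> ^^ n\<close> is \<open>\<beta>\<close> to the power \<open>-n\<close>.\<close>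

definition aut_orbit :: "('g \<Rightarrow> 'g) \<Rightarrow> 'g \<Rightarrow> 'g set" where
  "aut_orbit \<beta> g = range (\<lambda>n. (\<beta> ^^ n) g) \<union> range (\<lambda>n. (inv \<beta> ^^ n) g)"

definition induced_automorphism ::
    "('g::group_add \<Rightarrow> 'g) \<Rightarrow> ('g op \<Rightarrow> 'g op) \<Rightarrow> bool" where
  "induced_automorphism \<beta> \<alpha> \<longleftrightarrow>
     star_automorphism reduced_group_cstar \<alpha> \<and>
     (\<forall>g. \<alpha> (left_regular g) = left_regular (\<beta> g))"

text \<open>The automorphism exists: it is conjugation by the unitary \<open>\<xi> \<mapsto> \<xi> \<circ> \<beta>\<^sup>-\<^sup>1\<close>.\<close>

lemma ell2_permutation_operator:
  assumes "bij \<pi>"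
  obtains U :: "'a op" where "\<And>x g. Rep_ell2 (blinfun_apply U x) g = Rep_ell2 x (\<pi> g)"
proof -
  define u :: "'a ell2 \<Rightarrow> 'a ell2" where "u = (\<lambda>x. Abs_ell2 (\<lambda>g. Rep_ell2 x (\<pi> g)))"
  have rep: "Rep_ell2 (u x) g = Rep_ell2 x (\<pi> g)" for x g
  proof -
    have "(\<lambda>g. (cmod (Rep_ell2 x (\<pi> g)))\<^sup>2) summable_on UNIV"
      using summable_on_reindex_bij_betw[OF assms, of "\<lambda>g. (cmod (Rep_ell2 x g))\<^sup>2"] Rep_ell2[of x]
      by simp
    then show ?thesis by (simp add: u_def Abs_ell2_inverse)
  qed
  have "cinner (u x) (u x) = cinner x x" for x
    using infsum_reindex_bij_betw[OF assms, of "\<lambda>g. Rep_ell2 x g * cnj (Rep_ell2 x g)"]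
    by (simp add: cinner.rep_eq rep)
  then have "norm (u x) \<le> norm x * 1" for x
    by (simp add: norm_eq_sqrt_inner inner_ell2_def)
  moreover have "u (x + y) = u x + u y" for x y
    by (rule Rep_ell2_inject[THEN iffD1]) (simp add: fun_eq_iff rep plus_ell2.rep_eq)
  moreover have "u (r *\<^sub>R x) = r *\<^sub>R u x" for r x
    by (rule Rep_ell2_inject[THEN iffD1]) (simp add: fun_eq_iff rep scaleR_ell2.rep_eq)
  ultimately have "bounded_linear u" by (intro bounded_linear_intro)
  then have "blinfun_apply (Blinfun u) = u" by (rule bounded_linear_Blinfun_apply)
  with rep that[of "Blinfun u"] show thesis by simp
qed

lemma conjugation_reduced_group_cstar:
  fixes \<beta> :: "'g::group_add \<Rightarrow> 'g"
  assumes \<beta>: "group_automorphism \<beta>"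
    and U: "\<And>x g. Rep_ell2 (blinfun_apply U x) g = Rep_ell2 x (inv \<beta> g)"
    and V: "\<And>x g. Rep_ell2 (blinfun_apply V x) g = Rep_ell2 x (\<beta> g)"
  shows "blinfun_apply U (blinfun_apply V x) = x" "blinfun_apply V (blinfun_apply U x) = x"
    and "cinner (blinfun_apply U x) y = cinner x (blinfun_apply V y)"
    and "U o\<^sub>L left_regular g o\<^sub>L V = left_regular (\<beta> g)"
    and "V o\<^sub>L left_regular (\<beta> g) o\<^sub>L U = left_regular g"
    and "complex_linear_on UNIV (blinfun_apply U)" "complex_linear_on UNIV (blinfun_apply V)"
    and "T \<in> reduced_group_cstar \<Longrightarrow> U o\<^sub>L T o\<^sub>L V \<in> reduced_group_cstar"
    and "T \<in> reduced_group_cstar \<Longrightarrow> V o\<^sub>L T o\<^sub>L U \<in> reduced_group_cstar"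
proof -
  have bij: "bij \<beta>" and hom: "\<And>g h. \<beta> (g + h) = \<beta> g + \<beta> h"
    using \<beta> by (auto simp: group_automorphism_def)
  have inv [simp]: "\<beta> (inv \<beta> g) = g" "inv \<beta> (\<beta> g) = g" for g
    using bij by (simp_all add: bij_is_surj surj_f_inv_f bij_is_inj)
  have "\<beta> 0 = 0" by (metis hom add.right_neutral add_left_cancel)
  then have neg: "\<beta> (- g) = - \<beta> g" for g
    using hom[of g "- g"] by (simp add: eq_neg_iff_add_eq_0 flip: neg_eq_iff_add_eq_0)
  have ext: "x = y" if "\<And>g. Rep_ell2 x g = Rep_ell2 y g" for x y :: "'g ell2"
    using that by (auto simp flip: Rep_ell2_inject)
  show UV: "blinfun_apply U (blinfun_apply V x) = x" and VU: "blinfun_apply V (blinfun_apply U x) = x"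
    for x by (auto intro!: ext simp: U V)
  show adj: "cinner (blinfun_apply U x) y = cinner x (blinfun_apply V y)" for x y
    using infsum_reindex_bij_betw[OF bij, of "\<lambda>g. Rep_ell2 x (inv \<beta> g) * cnj (Rep_ell2 y g)"]
    by (simp add: cinner.rep_eq U V)
  have adj': "cinner (blinfun_apply V x) y = cinner x (blinfun_apply U y)" for x y
    using adj[of "blinfun_apply V x" "blinfun_apply U y"] by (simp add: UV VU)
  show UlV: "U o\<^sub>L left_regular g o\<^sub>L V = left_regular (\<beta> g)" for g
    by (rule blinfun_eqI, rule ext)
      (simp add: U V left_regular.rep_eq left_shift.rep_eq hom neg)
  show VlU: "V o\<^sub>L left_regular (\<beta> g) o\<^sub>L U = left_regular g" for g
    unfolding UlV[symmetric] by (rule blinfun_eqI) (simp add: VU)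
  show Ulin: "complex_linear_on UNIV (blinfun_apply U)"
    by (auto simp: complex_linear_on_def blinfun.add_right intro!: ext simp: U scaleC_ell2.rep_eq)
  show Vlin: "complex_linear_on UNIV (blinfun_apply V)"
    by (auto simp: complex_linear_on_def blinfun.add_right intro!: ext simp: V scaleC_ell2.rep_eq)
  have pre: "P o\<^sub>L T o\<^sub>L Q \<in> reduced_group_cstar"
    if T: "T \<in> reduced_group_cstar"
      and PQ: "\<And>x. blinfun_apply P (blinfun_apply Q x) = x"
      and QP: "\<And>x. blinfun_apply Q (blinfun_apply P x) = x"
      and PQadj: "\<And>x y. cinner (blinfun_apply P x) y = cinner x (blinfun_apply Q y)"
      and QPadj: "\<And>x y. cinner (blinfun_apply Q x) y = cinner x (blinfun_apply P y)"
      and Plin: "complex_linear_on UNIV (blinfun_apply P)"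
      and Qlin: "complex_linear_on UNIV (blinfun_apply Q)"
      and gen: "\<And>g. P o\<^sub>L left_regular g o\<^sub>L Q \<in> range left_regular"
    for P Q T :: "'g op"
    unfolding reduced_group_cstar_def
  proof (rule InterI)
    fix A :: "'g op set"
    assume "A \<in> {A. cstar_algebra A \<and> range left_regular \<subseteq> A}"
    then have A: "cstar_algebra A" and lA: "range left_regular \<subseteq> A" by auto
    define B where "B = {T. P o\<^sub>L T o\<^sub>L Q \<in> A}"
    have inverse_conj: "Q o\<^sub>L (P o\<^sub>L S o\<^sub>L Q) o\<^sub>L P = S" "P o\<^sub>L (Q o\<^sub>L S o\<^sub>L P) o\<^sub>L Q = S" for S
      by (rule blinfun_eqI, simp add: PQ QP)+
    have "cstar_algebra B"
      unfolding cstar_algebra_def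
    proof (intro conjI ballI allI)
      fix S assume S: "S \<in> B"
      have "complex_linear_on UNIV (blinfun_apply (P o\<^sub>L S o\<^sub>L Q))"
        using A S by (simp add: cstar_algebra_def B_def)
      with Plin Qlin have "complex_linear_on UNIV (blinfun_apply (Q o\<^sub>L (P o\<^sub>L S o\<^sub>L Q) o\<^sub>L P))"
        by (simp add: complex_linear_on_def)
      then show "complex_linear_on UNIV (blinfun_apply S)" by (simp only: inverse_conj)
      show "c *\<^sub>C S \<in> B" for c
      proof -
        have "P o\<^sub>L (c *\<^sub>C S) o\<^sub>L Q = c *\<^sub>C (P o\<^sub>L S o\<^sub>L Q)"
          using Plin by (intro blinfun_eqI) (simp add: scaleC_blinfun.rep_eq complex_linear_on_def)
        then show ?thesis using A S by (simp add: cstar_algebra_def B_def)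
      qed
      have "\<exists>R\<in>A. is_adjoint (P o\<^sub>L S o\<^sub>L Q) R"
        using A S by (simp add: cstar_algebra_def B_def)
      then obtain R where R: "R \<in> A" "is_adjoint (P o\<^sub>L S o\<^sub>L Q) R" by blast
      have "cinner (blinfun_apply S x) y = cinner x (blinfun_apply (Q o\<^sub>L R o\<^sub>L P) y)" for x y
      proof -
        have "cinner (blinfun_apply S x) y
            = cinner (blinfun_apply (P o\<^sub>L S o\<^sub>L Q) (blinfun_apply P x)) (blinfun_apply P y)"
          by (simp add: QP PQadj)
        also have "\<dots> = cinner (blinfun_apply P x) (blinfun_apply R (blinfun_apply P y))"
          using R by (simp only: is_adjoint_def)
        finally show ?thesis by (simp add: PQadj)
      qed
      then have "is_adjoint S (Q o\<^sub>L R o\<^sub>L P)" by (simp add: is_adjoint_def)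
      moreover have "Q o\<^sub>L R o\<^sub>L P \<in> B" using R by (simp add: B_def inverse_conj)
      ultimately show "\<exists>T\<in>B. is_adjoint S T" by blast
    next
      fix S T assume ST: "S \<in> B" "T \<in> B"
      have "P o\<^sub>L (S + T) o\<^sub>L Q = (P o\<^sub>L S o\<^sub>L Q) + (P o\<^sub>L T o\<^sub>L Q)"
        by (rule blinfun_eqI) (simp add: blinfun.add_left blinfun.add_right)
      then show "S + T \<in> B" using A ST by (simp add: cstar_algebra_def B_def)
      have "P o\<^sub>L (S o\<^sub>L T) o\<^sub>L Q = (P o\<^sub>L S o\<^sub>L Q) o\<^sub>L (P o\<^sub>L T o\<^sub>L Q)"
        by (rule blinfun_eqI) (simp add: QP)
      then show "S o\<^sub>L T \<in> B" using A ST by (simp add: cstar_algebra_def B_def)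
    next
      have "P o\<^sub>L 0 o\<^sub>L Q = 0" by (rule blinfun_eqI) simp
      then show "0 \<in> B" using A by (simp add: cstar_algebra_def B_def)
    next
      have "continuous_on UNIV (\<lambda>T. P o\<^sub>L T o\<^sub>L Q)"
        by (intro continuous_intros bounded_bilinear.continuous_on[OF bounded_bilinear_blinfun_compose])
      moreover have "closed A" using A by (simp add: cstar_algebra_def)
      ultimately show "closed B"
        using continuous_closed_vimage[of A "\<lambda>T. P o\<^sub>L T o\<^sub>L Q"]
        by (simp add: B_def vimage_def continuous_on_eq_continuous_at)
    qed
    moreover have "range left_regular \<subseteq> B" using gen lA by (auto simp: B_def)
    ultimately have "T \<in> B" using T by (auto simp: reduced_group_cstar_def)
    then show "P o\<^sub>L T o\<^sub>L Q \<in> A" by (simp add: B_def)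
  qed
  show "U o\<^sub>L T o\<^sub>L V \<in> reduced_group_cstar" if "T \<in> reduced_group_cstar"
    using that UV VU adj adj' Ulin Vlin by (rule pre) (simp add: UlV)
  have "V o\<^sub>L left_regular g o\<^sub>L U \<in> range left_regular" for g
    using VlU[of "inv \<beta> g"] by simp
  then show "V o\<^sub>L T o\<^sub>L U \<in> reduced_group_cstar" if "T \<in> reduced_group_cstar"
    using that VU UV adj' adj Vlin Ulin by (intro pre)
qed

lemma induced_automorphism_exists:
  assumes "group_automorphism \<beta>"
  shows "\<exists>\<alpha>. induced_automorphism \<beta> \<alpha>"
proof -
  have bij: "bij \<beta>" using assms by (simp add: group_automorphism_def)
  obtain V where V: "\<And>x g. Rep_ell2 (blinfun_apply V x) g = Rep_ell2 x (\<beta> g)"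
    using ell2_permutation_operator[OF bij] by blast
  obtain U where U: "\<And>x g. Rep_ell2 (blinfun_apply U x) g = Rep_ell2 x (inv \<beta> g)"
    using ell2_permutation_operator[OF bij_imp_bij_inv[OF bij]] by blast
  note UV = conjugation_reduced_group_cstar[OF assms U V]
  have adj': "cinner (blinfun_apply V x) y = cinner x (blinfun_apply U y)" for x y
    using UV(3)[of "blinfun_apply V x" "blinfun_apply U y"] by (simp add: UV(1,2))
  define \<alpha> where "\<alpha> T = U o\<^sub>L T o\<^sub>L V" for T
  have "bij_betw \<alpha> reduced_group_cstar reduced_group_cstar"
  proof (rule bij_betwI[where g = "\<lambda>T. V o\<^sub>L T o\<^sub>L U"])
    show "V o\<^sub>L \<alpha> T o\<^sub>L U = T" "\<alpha> (V o\<^sub>L T o\<^sub>L U) = T" for T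
      by (rule blinfun_eqI, simp add: \<alpha>_def UV(1,2))+
  qed (auto simp: \<alpha>_def UV(8,9))
  moreover have "complex_linear_on reduced_group_cstar \<alpha>"
    using UV(6) unfolding complex_linear_on_def \<alpha>_def
    by (auto intro!: blinfun_eqI simp: blinfun.add_left blinfun.add_right scaleC_blinfun.rep_eq)
  moreover have "\<alpha> (S o\<^sub>L T) = \<alpha> S o\<^sub>L \<alpha> T" for S T
    by (rule blinfun_eqI) (simp add: \<alpha>_def UV(2))
  moreover have "is_adjoint (\<alpha> S) (\<alpha> T)" if "is_adjoint S T" for S T
    using that by (simp add: is_adjoint_def \<alpha>_def UV(3) adj')
  ultimately have "induced_automorphism \<beta> \<alpha>"
    by (simp add: induced_automorphism_def star_automorphism_def \<alpha>_def UV(4))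
  then show ?thesis by blast
qed

end

theory Submission
  imports Defs
begin

text \<open>The expectation \<open>E\<close> is the norm limit of the averages \<open>(1/n) \<Sum>k<n. \<alpha>\<^sup>k(x)\<close>, and both its existence
  and the mixing property come from one estimate. Let \<open>g\<close> have an infinite orbit. The elements
  \<open>\<beta>\<^sup>k(g)\<close> are then distinct and all have the length of \<open>g\<close>, so rapid decay bounds
  \<open>\<Sum>k<n. c\<^sub>k \<lambda>(\<beta>\<^sup>k(g))\<close>, for coefficients of modulus one, by a constant depending on \<open>g\<close> times the
  \<open>\<ell>\<^sup>2\<close>-norm \<open>\<surd>n\<close> of the coefficients (lemma \<open>RD_group_orbit_decay\<close>).

  With \<open>c\<^sub>k = 1\<close> the averages of \<open>\<lambda>(g)\<close> tend to \<open>0\<close> in norm. If instead \<open>c\<^sub>k\<close> is the conjugate phase of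
  \<open>\<phi>(\<lambda>(\<beta>\<^sup>k(g)))\<close>, the estimate gives \<open>\<Sum>k<n. \<bar>\<phi>(\<lambda>(\<beta>\<^sup>k(g)))\<bar> = O(\<surd>n)\<close>, which is strict weak mixing for
  \<open>\<lambda>(g)\<close>, as \<open>E(\<lambda>(g)) = 0\<close> (lemma \<open>orbit_decay_functional\<close>). If the orbit of \<open>g\<close> is a singleton, \<open>\<lambda>(g)\<close> is fixed by
  \<open>\<alpha>\<close> and both claims are trivial.

  Both properties then pass from the generators to the whole algebra: each holds on a closed linear
  subspace, because \<open>\<alpha>\<close>, the averages and \<open>\<phi>\<close> are contractive, and the reduced group
  C*-algebra is the closed linear span of the operators \<open>\<lambda>(g)\<close>. Contractivity of \<open>\<alpha>\<close> is not part of
  the definition of a *-automorphism; it is derived from the existence of square roots of \<open>1 - x\<^sup>*x\<close>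
  for \<open>\<parallel>x\<parallel> < 1\<close> (lemma \<open>unital_star_homomorphism_contractive\<close>). That the limit of the
  averages is a conditional expectation onto the fixed points is the mean ergodic argument of lemma
  \<open>conditional_expectation_ergodic_limit\<close>.\<close>

section \<open>Complex subspaces and linear maps on them\<close>

lemma scaleC_one [simp]: "1 *\<^sub>C x = (x :: 'a::complex_normed_vector)"
  using scaleR_scaleC[of 1 x] by simp

lemma scaleC_zero_left [simp]: "0 *\<^sub>C x = (0 :: 'a::complex_normed_vector)"
  using norm_scaleC[of 0 x] by simp

lemma scaleC_zero_right [simp]: "c *\<^sub>C 0 = (0 :: 'a::complex_normed_vector)"
  using norm_scaleC[of c "0::'a"] by simp

definition complex_subspace :: "'a::complex_normed_vector set \<Rightarrow> bool" where
  "complex_subspace A \<longleftrightarrow>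
     0 \<in> A \<and> (\<forall>x\<in>A. \<forall>y\<in>A. x + y \<in> A) \<and> (\<forall>c. \<forall>x\<in>A. c *\<^sub>C x \<in> A)"

lemma cstar_algebra_subspace: "cstar_algebra A \<Longrightarrow> complex_subspace A"
  by (simp add: cstar_algebra_def complex_subspace_def)

context
  fixes A :: "'a::complex_normed_vector set"
  assumes A: "complex_subspace A"
begin

lemma complex_subspace_scaleR: "x \<in> A \<Longrightarrow> r *\<^sub>R x \<in> A"
  using A by (simp add: complex_subspace_def scaleR_scaleC)

lemma complex_subspace_diff: "x \<in> A \<Longrightarrow> y \<in> A \<Longrightarrow> x - y \<in> A"
  using A complex_subspace_scaleR[of y "- 1"]
  by (metis complex_subspace_def diff_conv_add_uminus scaleR_minus1_left)

lemma complex_subspace_sum: "(\<And>i. i \<in> I \<Longrightarrow> x i \<in> A) \<Longrightarrow> sum x I \<in> A"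
  using A by (induction I rule: infinite_finite_induct) (auto simp: complex_subspace_def)

context
  fixes f :: "'a \<Rightarrow> 'b::complex_normed_vector"
  assumes f: "complex_linear_on A f"
begin

lemma complex_linear_on_zero: "f 0 = 0"
proof -
  have "f (0 *\<^sub>C 0) = 0 *\<^sub>C f 0"
    using A f unfolding complex_linear_on_def complex_subspace_def by blast
  then show ?thesis by simp
qed

lemma complex_linear_on_scaleR: "x \<in> A \<Longrightarrow> f (r *\<^sub>R x) = r *\<^sub>R f x"
  using f by (simp add: complex_linear_on_def scaleR_scaleC)

lemma complex_linear_on_diff:
  assumes "x \<in> A" "y \<in> A"
  shows "f (x - y) = f x - f y"
proof -
  have "f (x + (- 1) *\<^sub>R y) = f x + (- 1) *\<^sub>R f y"
    using f assms complex_subspace_scaleR[of y "- 1"] complex_linear_on_scaleR[of y "- 1"]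
    by (simp only: complex_linear_on_def)
  then show ?thesis by simp
qed

lemma complex_linear_on_sum:
  assumes "\<And>i. i \<in> I \<Longrightarrow> x i \<in> A"
  shows "f (sum x I) = (\<Sum>i\<in>I. f (x i))"
  using assms
proof (induction I rule: infinite_finite_induct)
  case (insert i I)
  then show ?case
    using f complex_subspace_sum[of I x] by (simp add: complex_linear_on_def)
qed (simp_all add: complex_linear_on_zero)

end

end


section \<open>The Hilbert space of square-summable functions\<close>

lemma summable_ell2: "(\<lambda>g. (cmod (Rep_ell2 x g))\<^sup>2) summable_on UNIV"
  using Rep_ell2[of x] by simp

lemma norm_ell2_squared: "(norm x)\<^sup>2 = (\<Sum>\<^sub>\<infinity>g. (cmod (Rep_ell2 x g))\<^sup>2)"
proof -
  have "(\<lambda>g. Rep_ell2 x g * cnj (Rep_ell2 x g)) summable_on UNIV"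
    by (rule abs_summable_summable[OF ell2_abs_summable_product[OF summable_ell2 summable_ell2]])
  from infsum_Re[OF this]
  have "(norm x)\<^sup>2 = (\<Sum>\<^sub>\<infinity>g. Re (Rep_ell2 x g * cnj (Rep_ell2 x g)))"
    by (simp only: power2_norm_eq_inner inner_ell2_def cinner.rep_eq)
  then show ?thesis by (simp add: cmod_power2 flip: power2_eq_square)
qed

lemma sum_ell2_le_norm:
  assumes "finite F"
  shows "(\<Sum>g\<in>F. (cmod (Rep_ell2 x g))\<^sup>2) \<le> (norm x)\<^sup>2"
  unfolding norm_ell2_squared
  by (rule finite_sum_le_infsum[OF summable_ell2 assms]) simp_all

lemma coordinate_le_norm: "cmod (Rep_ell2 x g) \<le> norm x"
  using sum_ell2_le_norm[of "{g}" x] by (simp add: power2_le_iff_abs_le)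

lemma ell2_of_bounded_sums:
  assumes "\<And>F. finite F \<Longrightarrow> (\<Sum>g\<in>F. (cmod (f g))\<^sup>2) \<le> r\<^sup>2" "0 \<le> r"
  obtains x where "Rep_ell2 x = f" "norm x \<le> r"
proof
  have summable: "(\<lambda>g. (cmod (f g))\<^sup>2) summable_on UNIV"
    using assms(1) by (intro nonneg_bdd_above_summable_on bdd_aboveI2) auto
  then show rep: "Rep_ell2 (Abs_ell2 f) = f" by (simp add: Abs_ell2_inverse)
  have "(norm (Abs_ell2 f))\<^sup>2 \<le> r\<^sup>2"
    unfolding norm_ell2_squared rep by (rule infsum_le_finite_sums[OF summable]) (rule assms(1))
  then show "norm (Abs_ell2 f) \<le> r" using assms(2) by (rule power2_le_imp_le)
qed

text \<open>Completeness is the usual two-step argument: the coordinates of a Cauchy sequence converge, and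
  finite partial sums of \<open>\<bar>X m - X n\<bar>\<^sup>2\<close> pass to the limit in \<open>m\<close> with the bound kept.\<close>

instance ell2 :: (type) banach
proof
  fix X :: "nat \<Rightarrow> 'a ell2"
  assume X: "Cauchy X"
  have "Cauchy (\<lambda>n. Rep_ell2 (X n) g)" for g
  proof (rule metric_CauchyI)
    fix e :: real assume "0 < e"
    then obtain N where N: "\<And>m n. N \<le> m \<Longrightarrow> N \<le> n \<Longrightarrow> dist (X m) (X n) < e"
      using metric_CauchyD[OF X] by blast
    have "dist (Rep_ell2 (X m) g) (Rep_ell2 (X n) g) \<le> dist (X m) (X n)" for m n
      using coordinate_le_norm[of "X m - X n" g] by (simp add: dist_norm minus_ell2.rep_eq)
    with N show "\<exists>M. \<forall>m\<ge>M. \<forall>n\<ge>M. dist (Rep_ell2 (X m) g) (Rep_ell2 (X n) g) < e"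
      by (meson le_less_trans)
  qed
  then have "\<forall>g. \<exists>l. (\<lambda>n. Rep_ell2 (X n) g) \<longlonglongrightarrow> l"
    by (simp add: Cauchy_convergent_iff convergent_def)
  then obtain f where f: "\<And>g. (\<lambda>n. Rep_ell2 (X n) g) \<longlonglongrightarrow> f g" by metis
  have close: "\<exists>N. \<forall>n\<ge>N. \<forall>F. finite F \<longrightarrow> (\<Sum>g\<in>F. (cmod (f g - Rep_ell2 (X n) g))\<^sup>2) \<le> e\<^sup>2"
    if e: "0 < e" for e
  proof -
    obtain N where N: "\<And>m n. N \<le> m \<Longrightarrow> N \<le> n \<Longrightarrow> norm (X m - X n) < e"
      using CauchyD[OF X e] by blast
    have "(\<Sum>g\<in>F. (cmod (f g - Rep_ell2 (X n) g))\<^sup>2) \<le> e\<^sup>2" if "N \<le> n" "finite F" for n F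
    proof (rule tendsto_upperbound)
      show "(\<lambda>m. \<Sum>g\<in>F. (cmod (Rep_ell2 (X m) g - Rep_ell2 (X n) g))\<^sup>2)
              \<longlonglongrightarrow> (\<Sum>g\<in>F. (cmod (f g - Rep_ell2 (X n) g))\<^sup>2)"
        by (intro tendsto_intros f)
      show "\<forall>\<^sub>F m in sequentially. (\<Sum>g\<in>F. (cmod (Rep_ell2 (X m) g - Rep_ell2 (X n) g))\<^sup>2) \<le> e\<^sup>2"
      proof (rule eventually_sequentiallyI)
        fix m assume "N \<le> m"
        have "(\<Sum>g\<in>F. (cmod (Rep_ell2 (X m) g - Rep_ell2 (X n) g))\<^sup>2) \<le> (norm (X m - X n))\<^sup>2"
          using sum_ell2_le_norm[OF that(2), of "X m - X n"] by (simp add: minus_ell2.rep_eq)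
        also have "\<dots> \<le> e\<^sup>2"
          using N[OF \<open>N \<le> m\<close> \<open>N \<le> n\<close>] by (intro power_mono) simp_all
        finally show "(\<Sum>g\<in>F. (cmod (Rep_ell2 (X m) g - Rep_ell2 (X n) g))\<^sup>2) \<le> e\<^sup>2" .
      qed
    qed simp
    then show ?thesis by blast
  qed
  obtain N where "\<And>F. finite F \<Longrightarrow> (\<Sum>g\<in>F. (cmod (f g - Rep_ell2 (X N) g))\<^sup>2) \<le> 1\<^sup>2"
    using close[of 1] by auto
  then obtain d where d: "Rep_ell2 d = (\<lambda>g. f g - Rep_ell2 (X N) g)"
    by (rule ell2_of_bounded_sums) auto
  have "X \<longlonglongrightarrow> X N + d"
  proof (rule LIMSEQ_I)
    fix r :: real assume r: "0 < r"
    then obtain M where M: "\<And>n F. M \<le> n \<Longrightarrow> finite F \<Longrightarrow>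
        (\<Sum>g\<in>F. (cmod (f g - Rep_ell2 (X n) g))\<^sup>2) \<le> (r / 2)\<^sup>2"
      using close[of "r / 2"] by auto
    have "norm (X n - (X N + d)) < r" if n: "M \<le> n" for n
    proof -
      obtain y where y: "Rep_ell2 y = (\<lambda>g. f g - Rep_ell2 (X n) g)" "norm y \<le> r / 2"
      proof (rule ell2_of_bounded_sums)
        show "(\<Sum>g\<in>F. (cmod (f g - Rep_ell2 (X n) g))\<^sup>2) \<le> (r / 2)\<^sup>2" if "finite F" for F
          using that by (rule M[OF n])
      qed (use r in simp_all)
      have "y = X N + d - X n"
        by (rule Rep_ell2_inject[THEN iffD1])
          (simp add: fun_eq_iff y d minus_ell2.rep_eq plus_ell2.rep_eq)
      with y(2) r show ?thesis by (simp add: norm_minus_commute)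
    qed
    then show "\<exists>M. \<forall>n\<ge>M. norm (X n - (X N + d)) < r" by blast
  qed
  then show "convergent X" by (auto simp: convergent_def)
qed

lemma cinner_scaleC_left: "cinner (c *\<^sub>C x) y = c * cinner x y"
  by transfer (simp add: mult.assoc infsum_cmult_right')

lemma cinner_commute: "cinner x y = cnj (cinner y x)"
  by transfer (simp flip: infsum_cnj add: mult.commute)

lemma cinner_scaleC_right: "cinner x (c *\<^sub>C y) = cnj c * cinner x y"
  by (subst (1 2) cinner_commute) (simp add: cinner_scaleC_left)

text \<open>Reduces statements about \<^const>\<open>cinner\<close> to the real inner product, for which additivity and
  continuity are available.\<close>

lemma cinner_eq_inner: "cinner x y = Complex (inner x y) (inner ((- \<i>) *\<^sub>C x) y)"
  by (simp add: inner_ell2_def cinner_scaleC_left complex_eq_iff)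

lemma cinner_add_left: "cinner (x + y) z = cinner x z + cinner y z"
  by (simp add: cinner_eq_inner complex_eq_iff inner_add_left scaleC_add_right)

lemma cinner_add_right: "cinner x (y + z) = cinner x y + cinner x z"
  by (simp add: cinner_eq_inner complex_eq_iff inner_add_right)

lemma tendsto_cinner:
  assumes "(X \<longlongrightarrow> x) F" "(Y \<longlongrightarrow> y) F"
  shows "((\<lambda>n. cinner (X n) (Y n)) \<longlongrightarrow> cinner x y) F"
  unfolding cinner_eq_inner
  by (intro tendsto_Complex tendsto_inner bounded_linear.tendsto[OF bounded_linear_scaleC] assms)


section \<open>Adjoints\<close>

lemma is_adjoint_inner: "is_adjoint S T \<Longrightarrow> inner (blinfun_apply S x) y = inner x (blinfun_apply T y)"
  by (simp add: is_adjoint_def inner_ell2_def)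

lemma is_adjoint_sym: "is_adjoint S T \<Longrightarrow> is_adjoint T S"
  unfolding is_adjoint_def by (metis cinner_commute)

lemma is_adjoint_unique:
  assumes "is_adjoint S T" "is_adjoint S T'"
  shows "T = T'"
proof (rule blinfun_eqI)
  fix y
  have "inner x (blinfun_apply T y) = inner x (blinfun_apply T' y)" for x
    using is_adjoint_inner[OF assms(1), of x y] is_adjoint_inner[OF assms(2), of x y] by (rule trans[OF sym])
  then show "blinfun_apply T y = blinfun_apply T' y" by (rule vector_eq_ldot[THEN iffD1, OF allI])
qed

lemma is_adjoint_zero: "is_adjoint 0 0"
  by (simp add: is_adjoint_def cinner_eq_inner)

lemma is_adjoint_id: "is_adjoint id_blinfun id_blinfun"
  by (simp add: is_adjoint_def)

lemma is_adjoint_add: "is_adjoint S T \<Longrightarrow> is_adjoint S' T' \<Longrightarrow> is_adjoint (S + S') (T + T')"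
  by (simp add: is_adjoint_def blinfun.add_left cinner_add_left cinner_add_right)

lemma is_adjoint_scaleC: "is_adjoint S T \<Longrightarrow> is_adjoint (c *\<^sub>C S) (cnj c *\<^sub>C T)"
  by (simp add: is_adjoint_def scaleC_blinfun.rep_eq cinner_scaleC_left cinner_scaleC_right)

lemma is_adjoint_scaleR: "is_adjoint S T \<Longrightarrow> is_adjoint (r *\<^sub>R S) (r *\<^sub>R T)"
  using is_adjoint_scaleC[of S T "complex_of_real r"] by (simp add: scaleR_scaleC)

lemma is_adjoint_diff: "is_adjoint S T \<Longrightarrow> is_adjoint S' T' \<Longrightarrow> is_adjoint (S - S') (T - T')"
  using is_adjoint_add[of S T "- S'" "- T'"] is_adjoint_scaleR[of S' T' "- 1"] by simp

lemma is_adjoint_compose: "is_adjoint S T \<Longrightarrow> is_adjoint S' T' \<Longrightarrow> is_adjoint (S o\<^sub>L S') (T' o\<^sub>L T)"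
  by (simp add: is_adjoint_def)

lemma is_adjoint_limit:
  assumes "S \<longlonglongrightarrow> s" "T \<longlonglongrightarrow> t" "\<And>n. is_adjoint (S n) (T n)"
  shows "is_adjoint s t"
  unfolding is_adjoint_def
proof (intro allI)
  fix x y
  have "(\<lambda>n. cinner (blinfun_apply (S n) x) y) \<longlonglongrightarrow> cinner (blinfun_apply s x) y"
    by (intro tendsto_cinner tendsto_intros blinfun.tendsto assms(1))
  moreover have "(\<lambda>n. cinner x (blinfun_apply (T n) y)) \<longlonglongrightarrow> cinner x (blinfun_apply t y)"
    by (intro tendsto_cinner tendsto_intros blinfun.tendsto assms(2))
  ultimately show "cinner (blinfun_apply s x) y = cinner x (blinfun_apply t y)"
    using assms(3) LIMSEQ_unique by (simp add: is_adjoint_def)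
qed

lemma norm_adjoint_le:
  assumes "is_adjoint S T"
  shows "norm T \<le> norm S"
proof (rule norm_blinfun_bound)
  fix y
  have "norm (blinfun_apply T y) * norm (blinfun_apply T y)
      = inner (blinfun_apply S (blinfun_apply T y)) y"
    by (simp add: is_adjoint_inner[OF assms] dot_square_norm power2_eq_square)
  also have "\<dots> \<le> norm (blinfun_apply S (blinfun_apply T y)) * norm y"
    by (rule norm_cauchy_schwarz)
  also have "\<dots> \<le> (norm S * norm (blinfun_apply T y)) * norm y"
    by (intro mult_right_mono norm_blinfun) simp
  finally have "norm (blinfun_apply T y) * norm (blinfun_apply T y)
      \<le> norm (blinfun_apply T y) * (norm S * norm y)" by (simp add: algebra_simps)
  then show "norm (blinfun_apply T y) \<le> norm S * norm y"
    by (cases "blinfun_apply T y = 0") simp_all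
qed simp

text \<open>The adjoints of a convergent sequence form a Cauchy sequence because adjunction is isometric, so
  the limit again has an adjoint; everything else is continuity of the operations.\<close>

lemma cstar_algebra_closure:
  assumes linear: "\<And>S. S \<in> D \<Longrightarrow> complex_linear_on UNIV (blinfun_apply S)"
    and subspace: "complex_subspace D"
    and mult: "\<And>S T. S \<in> D \<Longrightarrow> T \<in> D \<Longrightarrow> S o\<^sub>L T \<in> D"
    and adjoint: "\<And>S. S \<in> D \<Longrightarrow> \<exists>T\<in>D. is_adjoint S T"
  shows "cstar_algebra (closure D)"
  unfolding cstar_algebra_def
proof (intro conjI ballI allI)
  fix S assume "S \<in> closure D"
  then obtain X where X: "\<And>n. X n \<in> D" "X \<longlonglongrightarrow> S" by (auto simp: closure_sequential)
  have pointwise: "(\<lambda>n. blinfun_apply (X n) x) \<longlonglongrightarrow> blinfun_apply S x" for x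
    by (intro blinfun.tendsto X tendsto_const)
  have "blinfun_apply S (c *\<^sub>C x) = c *\<^sub>C blinfun_apply S x" for c x
  proof (rule LIMSEQ_unique[OF pointwise])
    show "(\<lambda>n. blinfun_apply (X n) (c *\<^sub>C x)) \<longlonglongrightarrow> c *\<^sub>C blinfun_apply S x"
      using bounded_linear.tendsto[OF bounded_linear_scaleC pointwise] linear[OF X(1)]
      by (simp add: complex_linear_on_def)
  qed
  then show "complex_linear_on UNIV (blinfun_apply S)"
    by (simp add: complex_linear_on_def blinfun.add_right)
  show "c *\<^sub>C S \<in> closure D" for c
    unfolding closure_sequential
    using X subspace bounded_linear.tendsto[OF bounded_linear_scaleC X(2)]
    by (intro exI[of _ "\<lambda>n. c *\<^sub>C X n"]) (simp add: complex_subspace_def)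
  obtain Y where Y: "\<And>n. Y n \<in> D" "\<And>n. is_adjoint (X n) (Y n)"
    using adjoint[OF X(1)] by metis
  have "Cauchy Y"
  proof (rule CauchyI)
    fix e :: real assume "0 < e"
    then obtain M where M: "\<And>m n. M \<le> m \<Longrightarrow> M \<le> n \<Longrightarrow> norm (X m - X n) < e"
      using CauchyD[OF LIMSEQ_imp_Cauchy[OF X(2)]] by blast
    have "norm (Y m - Y n) \<le> norm (X m - X n)" for m n
      by (intro norm_adjoint_le is_adjoint_diff Y)
    with M show "\<exists>M. \<forall>m\<ge>M. \<forall>n\<ge>M. norm (Y m - Y n) < e" by (meson le_less_trans)
  qed
  then obtain T where T: "Y \<longlonglongrightarrow> T" by (auto simp: Cauchy_convergent_iff convergent_def)
  show "\<exists>T\<in>closure D. is_adjoint S T"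
  proof
    show "is_adjoint S T" by (rule is_adjoint_limit[OF X(2) T Y(2)])
    show "T \<in> closure D" using Y(1) T by (auto simp: closure_sequential)
  qed
next
  fix S T assume "S \<in> closure D" "T \<in> closure D"
  then obtain X Y where XY: "\<And>n. X n \<in> D" "X \<longlonglongrightarrow> S" "\<And>n. Y n \<in> D" "Y \<longlonglongrightarrow> T"
    by (auto simp: closure_sequential)
  show "S + T \<in> closure D"
    unfolding closure_sequential
    using XY subspace tendsto_add[OF XY(2,4)]
    by (intro exI[of _ "\<lambda>n. X n + Y n"]) (simp add: complex_subspace_def)
  show "S o\<^sub>L T \<in> closure D"
    unfolding closure_sequential
    using XY mult bounded_bilinear.tendsto[OF bounded_bilinear_blinfun_compose XY(2,4)]
    by (intro exI[of _ "\<lambda>n. X n o\<^sub>L Y n"]) simp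
next
  show "0 \<in> closure D" using subspace closure_subset by (auto simp: complex_subspace_def)
qed simp


section \<open>Unital *-homomorphisms are contractive\<close>

text \<open>Writing the square root as \<open>1 - z\<close> turns \<open>(1 - z)\<^sup>2 = 1 - a\<close> into the fixed-point equation
  \<open>z = (a + z\<^sup>2) / 2\<close>, which needs no commutativity. The right-hand side maps the self-adjoint ball of
  radius \<open>\<rho> = 1 - \<surd>(1 - \<parallel>a\<parallel>)\<close> into itself, as \<open>\<rho>\<close> solves the same equation for
  \<open>\<parallel>a\<parallel>\<close>, and contracts by \<open>\<rho> < 1\<close> there.\<close>

lemma self_adjoint_square_root:
  assumes A: "cstar_algebra A" and id: "id_blinfun \<in> A"
    and a: "a \<in> A" "is_adjoint a a" "norm a < 1"
  obtains y where "y \<in> A" "is_adjoint y y" "y o\<^sub>L y = id_blinfun - a"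
proof -
  define \<rho> where "\<rho> = 1 - sqrt (1 - norm a)"
  have \<rho>: "0 \<le> \<rho>" "\<rho> < 1" using a(3) by (simp_all add: \<rho>_def)
  have \<rho>_eq: "norm a + \<rho> * \<rho> = 2 * \<rho>"
  proof -
    have "(1 - \<rho>) * (1 - \<rho>) = 1 - norm a" using a(3) by (simp add: \<rho>_def)
    then show ?thesis by (simp add: algebra_simps)
  qed
  define B where "B = {z \<in> A. is_adjoint z z \<and> norm z \<le> \<rho>}"
  define F where "F z = (1 / 2) *\<^sub>R (a + (z o\<^sub>L z))" for z
  note subspace = cstar_algebra_subspace[OF A]
  have "closed B"
    unfolding closed_sequential_limits
  proof (intro allI impI)
    fix X z assume X: "(\<forall>n. X n \<in> B) \<and> X \<longlonglongrightarrow> z"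
    have "closed A" using A by (simp add: cstar_algebra_def)
    with X have "z \<in> A" by (auto simp: B_def closed_sequential_limits)
    moreover have "is_adjoint z z" using X is_adjoint_limit[of X z X z] by (simp add: B_def)
    moreover have "norm z \<le> \<rho>"
    proof (rule tendsto_upperbound[OF tendsto_norm])
      show "X \<longlonglongrightarrow> z" using X by simp
    qed (use X in \<open>simp_all add: B_def\<close>)
    ultimately show "z \<in> B" by (simp add: B_def)
  qed
  then have "complete B" by (simp add: complete_eq_closed)
  moreover have "0 \<in> B" using subspace \<rho> by (simp add: B_def complex_subspace_def is_adjoint_zero)
  moreover have "F ` B \<subseteq> B"
  proof (intro image_subsetI)
    fix z assume z: "z \<in> B"
    have "norm (z o\<^sub>L z) \<le> \<rho> * \<rho>"
      using norm_blinfun_compose[of z z] z mult_mono[of "norm z" \<rho> "norm z" \<rho>] \<rho>(1)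
      by (simp add: B_def)
    then have "norm (F z) \<le> \<rho>"
      using norm_triangle_ineq[of a "z o\<^sub>L z"] \<rho>_eq by (simp add: F_def)
    moreover have "F z \<in> A"
      unfolding F_def using A a z
      by (intro complex_subspace_scaleR[OF subspace]) (simp add: cstar_algebra_def B_def)
    moreover have "is_adjoint (F z) (F z)"
      unfolding F_def using z a
      by (intro is_adjoint_scaleR is_adjoint_add is_adjoint_compose) (simp_all add: B_def)
    ultimately show "F z \<in> B" by (simp add: B_def)
  qed
  moreover have "dist (F z) (F w) \<le> \<rho> * dist z w" if "z \<in> B" "w \<in> B" for z w
  proof -
    have "F z - F w = (1 / 2) *\<^sub>R ((z o\<^sub>L (z - w)) + ((z - w) o\<^sub>L w))"
      by (rule blinfun_eqI) (simp add: F_def blinfun.bilinear_simps algebra_simps)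
    also have "norm \<dots> \<le> (1 / 2) * (norm z * norm (z - w) + norm (z - w) * norm w)"
      using norm_triangle_ineq[of "z o\<^sub>L (z - w)" "(z - w) o\<^sub>L w"]
        norm_blinfun_compose[of z "z - w"] norm_blinfun_compose[of "z - w" w] by simp
    also have "\<dots> \<le> (1 / 2) * (\<rho> * norm (z - w) + norm (z - w) * \<rho>)"
      using that by (intro mult_left_mono add_mono mult_right_mono) (auto simp: B_def)
    finally show ?thesis by (simp add: dist_norm)
  qed
  ultimately have "\<exists>!z\<in>B. F z = z"
    using \<rho> by (intro Banach_fix[where c = \<rho>]) auto
  then obtain z where z: "z \<in> B" "F z = z" by blast
  define y where "y = id_blinfun - z"
  have two_z: "a + (z o\<^sub>L z) = 2 *\<^sub>R z"
  proof -
    have "2 *\<^sub>R F z = a + (z o\<^sub>L z)" by (simp add: F_def)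
    then show ?thesis by (simp add: z(2))
  qed
  show thesis
  proof
    show "y \<in> A" using complex_subspace_diff[OF subspace id] z by (simp add: y_def B_def)
    show "is_adjoint y y" using z by (simp add: y_def B_def is_adjoint_diff is_adjoint_id)
    have "y o\<^sub>L y = id_blinfun - 2 *\<^sub>R z + (z o\<^sub>L z)"
      by (rule blinfun_eqI) (simp add: y_def blinfun.bilinear_simps scaleR_2)
    also have "\<dots> = id_blinfun - a" by (simp add: two_z[symmetric])
    finally show "y o\<^sub>L y = id_blinfun - a" .
  qed
qed

text \<open>If \<open>\<parallel>x\<parallel> < 1\<close> then \<open>1 - x\<^sup>*x = y\<^sup>2\<close> with \<open>y\<close> self-adjoint, a purely algebraic relation that
  the homomorphism keeps; evaluated at a vector \<open>v\<close> it says
  \<open>\<parallel>v\<parallel>\<^sup>2 - \<parallel>\<pi>(x)v\<parallel>\<^sup>2 = \<parallel>\<pi>(y)v\<parallel>\<^sup>2 \<ge> 0\<close>. Continuity of the homomorphism is thus automatic.\<close>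

lemma unital_star_homomorphism_contractive:
  fixes A :: "'a op set" and \<pi> :: "'a op \<Rightarrow> 'b op"
  assumes A: "cstar_algebra A" and id: "id_blinfun \<in> A"
    and linear: "complex_linear_on A \<pi>"
    and mult: "\<And>S T. S \<in> A \<Longrightarrow> T \<in> A \<Longrightarrow> \<pi> (S o\<^sub>L T) = \<pi> S o\<^sub>L \<pi> T"
    and star: "\<And>S T. S \<in> A \<Longrightarrow> T \<in> A \<Longrightarrow> is_adjoint S T \<Longrightarrow> is_adjoint (\<pi> S) (\<pi> T)"
    and unital: "\<pi> id_blinfun = id_blinfun"
    and x: "x \<in> A"
  shows "norm (\<pi> x) \<le> norm x"
proof -
  note subspace = cstar_algebra_subspace[OF A]
  have unit_ball: "norm (\<pi> x) \<le> 1" if x: "x \<in> A" "norm x < 1" for x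
  proof -
    obtain t where t: "t \<in> A" "is_adjoint x t" using A x by (auto simp: cstar_algebra_def)
    have "norm (t o\<^sub>L x) \<le> norm x * norm x"
      using norm_blinfun_compose[of t x] mult_right_mono[OF norm_adjoint_le[OF t(2)], of "norm x"]
      by simp
    also have "\<dots> < 1" using x(2) mult_strict_mono'[of "norm x" 1 "norm x" 1] by simp
    finally have "norm (t o\<^sub>L x) < 1" .
    moreover have tx: "t o\<^sub>L x \<in> A" using A t x by (simp add: cstar_algebra_def)
    moreover have "is_adjoint (t o\<^sub>L x) (t o\<^sub>L x)"
      using is_adjoint_compose[OF is_adjoint_sym[OF t(2)] t(2)] .
    ultimately obtain y where y: "y \<in> A" "is_adjoint y y" "y o\<^sub>L y = id_blinfun - (t o\<^sub>L x)"
      using self_adjoint_square_root[OF A id] by metis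
    have "\<pi> y o\<^sub>L \<pi> y = id_blinfun - (\<pi> t o\<^sub>L \<pi> x)"
      using mult[OF y(1) y(1)] mult[OF t(1) x(1)] complex_linear_on_diff[OF subspace linear id tx]
      by (simp add: y(3) unital)
    then have eq: "blinfun_apply (\<pi> y) (blinfun_apply (\<pi> y) v)
        = v - blinfun_apply (\<pi> t) (blinfun_apply (\<pi> x) v)" for v
      by (metis blinfun_apply_blinfun_compose blinfun.diff_left blinfun_apply_id_blinfun id_apply)
    have "(norm (blinfun_apply (\<pi> x) v))\<^sup>2 \<le> (norm v)\<^sup>2" for v
    proof -
      have "(norm (blinfun_apply (\<pi> y) v))\<^sup>2 = inner v (blinfun_apply (\<pi> y) (blinfun_apply (\<pi> y) v))"
        by (simp add: power2_norm_eq_inner is_adjoint_inner[OF star[OF y(1,1,2)]])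
      also have "\<dots> = (norm v)\<^sup>2 - (norm (blinfun_apply (\<pi> x) v))\<^sup>2"
        by (simp add: eq inner_diff_right power2_norm_eq_inner
            is_adjoint_inner[OF star[OF x(1) t]])
      finally show ?thesis using zero_le_power2[of "norm (blinfun_apply (\<pi> y) v)"] by simp
    qed
    then show ?thesis by (intro norm_blinfun_bound) (simp_all add: power2_le_iff_abs_le)
  qed
  show ?thesis
  proof (rule dense_ge)
    fix r assume r: "norm x < r"
    then have pos: "0 < r" using norm_ge_zero[of x] by linarith
    have "norm (\<pi> ((1 / r) *\<^sub>R x)) \<le> 1"
      using r pos by (intro unit_ball complex_subspace_scaleR[OF subspace x]) simp
    then show "norm (\<pi> x) \<le> r"
      using pos by (simp add: complex_linear_on_scaleR[OF subspace linear x])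
  qed
qed


section \<open>Ergodic averages of linear contractions\<close>

text \<open>Uniform boundedness makes the set of points of convergence closed, so that convergence need
  only be checked on elements with dense linear span.\<close>

lemma pointwise_convergence_subspace:
  fixes A :: "'a::complex_normed_vector set"
    and V :: "nat \<Rightarrow> 'a \<Rightarrow> 'b::{complex_normed_vector, banach}"
  assumes A: "complex_subspace A" "closed A"
    and linear: "\<And>n. complex_linear_on A (V n)"
    and bound: "\<And>n x. x \<in> A \<Longrightarrow> norm (V n x) \<le> norm x"
  shows "complex_subspace {x \<in> A. convergent (\<lambda>n. V n x)}" "closed {x \<in> A. convergent (\<lambda>n. V n x)}"
proof -
  have "convergent (\<lambda>n. V n (c *\<^sub>C x))" if "x \<in> A" "convergent (\<lambda>n. V n x)" for c x
    using that linear bounded_linear.tendsto[OF bounded_linear_scaleC]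
    unfolding convergent_def complex_linear_on_def by fastforce
  moreover have "convergent (\<lambda>n. V n (x + y))"
    if "x \<in> A" "y \<in> A" "convergent (\<lambda>n. V n x)" "convergent (\<lambda>n. V n y)" for x y
    using convergent_add[OF that(3,4)] linear that(1,2) by (simp add: complex_linear_on_def)
  moreover have "convergent (\<lambda>n. V n 0)"
    using complex_linear_on_zero[OF A(1) linear] by (simp add: convergent_const)
  ultimately show "complex_subspace {x \<in> A. convergent (\<lambda>n. V n x)}"
    using A(1) by (simp add: complex_subspace_def)
  show "closed {x \<in> A. convergent (\<lambda>n. V n x)}"
    unfolding closed_sequential_limits
  proof (intro allI impI)
    fix X x assume X: "(\<forall>j. X j \<in> {x \<in> A. convergent (\<lambda>n. V n x)}) \<and> X \<longlonglongrightarrow> x"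
    have x: "x \<in> A" using A(2) X unfolding closed_sequential_limits by blast
    have "Cauchy (\<lambda>n. V n x)"
    proof (rule CauchyI)
      fix e :: real assume e: "0 < e"
      obtain j where j: "norm (X j - x) < e / 3"
        using LIMSEQ_D[of X x "e / 3"] X e by auto
      have "Cauchy (\<lambda>n. V n (X j))" using X by (auto intro: convergent_Cauchy)
      then obtain M where M: "\<And>m n. M \<le> m \<Longrightarrow> M \<le> n \<Longrightarrow> norm (V m (X j) - V n (X j)) < e / 3"
        using CauchyD[of _ "e / 3"] e by (metis divide_pos_pos zero_less_numeral)
      have close: "norm (V n (X j) - V n x) < e / 3" for n
      proof -
        have "norm (V n (X j - x)) \<le> norm (X j - x)"
          using X x by (intro bound complex_subspace_diff[OF A(1)]) auto
        then show ?thesis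
          using complex_linear_on_diff[OF A(1) linear, of "X j" x] X x j by simp
      qed
      have "norm (V m x - V n x) < e" if "M \<le> m" "M \<le> n" for m n
        using norm_triangle_ineq[of "V m x - V m (X j)" "V m (X j) - V n x"]
          norm_triangle_ineq[of "V m (X j) - V n (X j)" "V n (X j) - V n x"]
          M[OF that] close[of m] close[of n] norm_minus_commute[of "V m x" "V m (X j)"] by simp
      then show "\<exists>M. \<forall>m\<ge>M. \<forall>n\<ge>M. norm (V m x - V n x) < e" by blast
    qed
    with x show "x \<in> {x \<in> A. convergent (\<lambda>n. V n x)}" by (simp add: Cauchy_convergent_iff)
  qed
qed

text \<open>Strong Cesaro convergence to \<open>0\<close> of uniformly bounded functionals is subadditive in the
  argument and is controlled by the norm, hence it too can be checked on a set with dense span.\<close>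

lemma cesaro_null_subspace:
  fixes A :: "'a::complex_normed_vector set" and u :: "nat \<Rightarrow> 'a \<Rightarrow> complex"
  assumes A: "complex_subspace A" "closed A"
    and linear: "\<And>k. complex_linear_on A (u k)"
    and bound: "\<And>k x. x \<in> A \<Longrightarrow> cmod (u k x) \<le> M * norm x"
  shows "complex_subspace {x \<in> A. (\<lambda>n. (1 / real n) * (\<Sum>k<n. cmod (u k x))) \<longlonglongrightarrow> 0}"
      (is "complex_subspace ?N")
    and "closed {x \<in> A. (\<lambda>n. (1 / real n) * (\<Sum>k<n. cmod (u k x))) \<longlonglongrightarrow> 0}"
proof -
  define s where "s n x = (1 / real n) * (\<Sum>k<n. cmod (u k x))" for n x
  have s_nonneg: "0 \<le> s n x" for n x by (simp add: s_def sum_nonneg)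
  have s_add: "s n (x + y) \<le> s n x + s n y" if "x \<in> A" "y \<in> A" for n x y
  proof -
    have "(\<Sum>k<n. cmod (u k (x + y))) \<le> (\<Sum>k<n. cmod (u k x) + cmod (u k y))"
      using linear that by (intro sum_mono) (simp add: complex_linear_on_def norm_triangle_ineq)
    then show ?thesis
      by (simp add: s_def sum.distrib divide_right_mono flip: add_divide_distrib)
  qed
  have s_scale: "s n (c *\<^sub>C x) = cmod c * s n x" if "x \<in> A" for n c x
    using linear that
    by (simp add: s_def complex_linear_on_def scaleC_complex_def norm_mult sum_distrib_left)
  have "(\<lambda>n. s n (c *\<^sub>C x)) \<longlonglongrightarrow> 0" if "x \<in> A" "(\<lambda>n. s n x) \<longlonglongrightarrow> 0" for c x
    using tendsto_mult_left_zero[OF that(2), of "cmod c"] that(1)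
    by (simp add: s_scale mult.commute)
  moreover have "(\<lambda>n. s n (x + y)) \<longlonglongrightarrow> 0"
    if "x \<in> A" "y \<in> A" "(\<lambda>n. s n x) \<longlonglongrightarrow> 0" "(\<lambda>n. s n y) \<longlonglongrightarrow> 0" for x y
  proof (rule tendsto_sandwich[of "\<lambda>_. 0" _ _ "\<lambda>n. s n x + s n y"])
    show "(\<lambda>n. s n x + s n y) \<longlonglongrightarrow> 0" using tendsto_add[OF that(3,4)] by simp
  qed (simp_all add: s_nonneg s_add that)
  moreover have "(\<lambda>n. s n 0) \<longlonglongrightarrow> 0"
    using complex_linear_on_zero[OF A(1) linear] by (simp add: s_def)
  ultimately have "complex_subspace {x \<in> A. (\<lambda>n. s n x) \<longlonglongrightarrow> 0}"
    using A(1) by (simp add: complex_subspace_def)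
  then show "complex_subspace ?N" by (simp only: s_def)
  have s_le: "s n x \<le> \<bar>M\<bar> * norm x" if "x \<in> A" for n x
  proof -
    have "(\<Sum>k<n. cmod (u k x)) \<le> (\<Sum>k<n. \<bar>M\<bar> * norm x)"
      using bound[OF that] by (intro sum_mono) (meson abs_ge_self mult_right_mono norm_ge_zero order_trans)
    then show ?thesis by (cases "n = 0") (simp_all add: s_def field_simps)
  qed
  have "closed {x \<in> A. (\<lambda>n. s n x) \<longlonglongrightarrow> 0}"
    unfolding closed_sequential_limits
  proof (intro allI impI)
    fix X x assume X: "(\<forall>j. X j \<in> {x \<in> A. (\<lambda>n. s n x) \<longlonglongrightarrow> 0}) \<and> X \<longlonglongrightarrow> x"
    have x: "x \<in> A" using A(2) X unfolding closed_sequential_limits by blast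
    have "(\<lambda>n. s n x) \<longlonglongrightarrow> 0"
    proof (rule LIMSEQ_I)
      fix e :: real assume e: "0 < e"
      have "(\<lambda>j. \<bar>M\<bar> * norm (x - X j)) \<longlonglongrightarrow> \<bar>M\<bar> * norm (x - x)"
        using X by (intro tendsto_intros) auto
      then obtain j where j: "\<bar>M\<bar> * norm (x - X j) < e / 2"
        using LIMSEQ_D[of "\<lambda>j. \<bar>M\<bar> * norm (x - X j)" 0 "e / 2"] e by auto
      obtain N where N: "\<And>n. N \<le> n \<Longrightarrow> s n (X j) < e / 2"
        using LIMSEQ_D[of "\<lambda>n. s n (X j)" 0 "e / 2"] X e s_nonneg by auto
      have "s n x < e" if "N \<le> n" for n
        using s_add[of "X j" "x - X j" n] s_le[of "x - X j" n] N[OF that] j X x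
          complex_subspace_diff[OF A(1), of x "X j"] by simp
      then show "\<exists>N. \<forall>n\<ge>N. norm (s n x - 0) < e" using s_nonneg by auto
    qed
    with x show "x \<in> {x \<in> A. (\<lambda>n. s n x) \<longlonglongrightarrow> 0}" by simp
  qed
  then show "closed {x \<in> A. (\<lambda>n. (1 / real n) * (\<Sum>k<n. cmod (u k x))) \<longlonglongrightarrow> 0}"
    by (simp only: s_def)
qed

definition ergodic_average :: "('a \<Rightarrow> 'a) \<Rightarrow> nat \<Rightarrow> 'a \<Rightarrow> 'a::real_normed_vector" where
  "ergodic_average T n x = (1 / real n) *\<^sub>R (\<Sum>k<n. (T ^^ k) x)"

definition ergodic_limit :: "('a \<Rightarrow> 'a) \<Rightarrow> 'a \<Rightarrow> 'a::real_normed_vector" where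
  "ergodic_limit T x = lim (\<lambda>n. ergodic_average T n x)"

locale linear_contraction =
  fixes A :: "'a::{complex_normed_vector, banach} set" and T :: "'a \<Rightarrow> 'a"
  assumes subspace: "complex_subspace A" and closed: "closed A"
    and linear: "complex_linear_on A T"
    and invariant: "\<And>x. x \<in> A \<Longrightarrow> T x \<in> A"
    and contractive: "\<And>x. x \<in> A \<Longrightarrow> norm (T x) \<le> norm x"
begin

lemma funpow_invariant: "x \<in> A \<Longrightarrow> (T ^^ k) x \<in> A"
  by (induction k) (simp_all add: invariant)

lemma funpow_linear: "complex_linear_on A (T ^^ k)"
proof (induction k)
  case (Suc k)
  then show ?case
    using linear funpow_invariant[of _ k] by (simp add: complex_linear_on_def)
qed (simp add: complex_linear_on_def)

lemma funpow_contractive: "x \<in> A \<Longrightarrow> norm ((T ^^ k) x) \<le> norm x"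
proof (induction k)
  case (Suc k)
  then show ?case using contractive[OF funpow_invariant[of x k]] by simp
qed simp

lemma nonexpansive:
  assumes "x \<in> A" "y \<in> A"
  shows "norm (T x - T y) \<le> norm (x - y)"
  using contractive[OF complex_subspace_diff[OF subspace assms]]
  by (simp add: complex_linear_on_diff[OF subspace linear assms])

text \<open>Continuity only along sequences in \<open>A\<close>, since the values of \<open>T\<close> outside \<open>A\<close> are arbitrary.\<close>

lemma tendsto_apply:
  assumes "X \<longlonglongrightarrow> x" "\<And>n. X n \<in> A" "x \<in> A"
  shows "(\<lambda>n. T (X n)) \<longlonglongrightarrow> T x"
proof (rule LIM_zero_cancel, rule Lim_null_comparison)
  show "\<forall>\<^sub>F n in sequentially. norm (T (X n) - T x) \<le> norm (X n - x)"
    by (intro always_eventually allI nonexpansive assms)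
  show "(\<lambda>n. norm (X n - x)) \<longlonglongrightarrow> 0"
    using assms(1) by (simp add: LIM_zero tendsto_norm_zero)
qed

lemma ergodic_average_invariant: "x \<in> A \<Longrightarrow> ergodic_average T n x \<in> A"
  unfolding ergodic_average_def
  by (intro complex_subspace_scaleR[OF subspace] complex_subspace_sum[OF subspace] funpow_invariant)

lemma ergodic_average_linear: "complex_linear_on A (ergodic_average T n)"
proof -
  have "(\<Sum>k<n. c *\<^sub>C (T ^^ k) x) = c *\<^sub>C (\<Sum>k<n. (T ^^ k) x)" for c x
    by (simp add: linear_sum[OF bounded_linear.linear[OF bounded_linear_scaleC]])
  then show ?thesis
    using funpow_linear
    by (simp add: complex_linear_on_def ergodic_average_def sum.distrib scaleC_add_right
        scaleR_scaleC scaleC_scaleC mult.commute)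
qed

lemma ergodic_average_contractive:
  assumes "x \<in> A"
  shows "norm (ergodic_average T n x) \<le> norm x"
proof (cases "n = 0")
  case False
  have "norm (\<Sum>k<n. (T ^^ k) x) \<le> (\<Sum>k<n. norm x)"
    by (intro sum_norm_le funpow_contractive assms)
  with False show ?thesis by (simp add: ergodic_average_def field_simps)
qed (simp add: ergodic_average_def)

lemma ergodic_average_fixed_point:
  assumes "T x = x" "0 < n"
  shows "ergodic_average T n x = x"
proof -
  have "(T ^^ k) x = x" for k using assms(1) by (induction k) simp_all
  with assms(2) show ?thesis by (simp add: ergodic_average_def sum_constant_scaleR)
qed

lemma ergodic_limit_eqI: "(\<lambda>n. ergodic_average T n x) \<longlonglongrightarrow> y \<Longrightarrow> ergodic_limit T x = y"
  unfolding ergodic_limit_def by (rule limI)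

lemma ergodic_average_tendsto_fixed_point: "T x = x \<Longrightarrow> (\<lambda>n. ergodic_average T n x) \<longlonglongrightarrow> x"
  by (rule tendsto_eventually)
    (auto intro!: eventually_sequentiallyI[of 1] simp: ergodic_average_fixed_point)

lemma ergodic_limit_fixed_point: "T x = x \<Longrightarrow> ergodic_limit T x = x"
  by (intro ergodic_limit_eqI ergodic_average_tendsto_fixed_point)

lemmas averages_converge_subspace =
  pointwise_convergence_subspace[OF subspace closed ergodic_average_linear ergodic_average_contractive]

context
  assumes convergent: "\<And>x. x \<in> A \<Longrightarrow> convergent (\<lambda>n. ergodic_average T n x)"
begin

lemma ergodic_average_tendsto: "x \<in> A \<Longrightarrow> (\<lambda>n. ergodic_average T n x) \<longlonglongrightarrow> ergodic_limit T x"
  unfolding ergodic_limit_def using convergent by (simp add: convergent_LIMSEQ_iff)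

lemma ergodic_limit_invariant: "x \<in> A \<Longrightarrow> ergodic_limit T x \<in> A"
  by (rule closed_sequentially[OF closed ergodic_average_invariant ergodic_average_tendsto])

lemma ergodic_limit_linear: "complex_linear_on A (ergodic_limit T)"
  unfolding complex_linear_on_def
proof (intro conjI ballI allI ergodic_limit_eqI)
  fix x y assume "x \<in> A" "y \<in> A"
  then show "(\<lambda>n. ergodic_average T n (x + y)) \<longlonglongrightarrow> ergodic_limit T x + ergodic_limit T y"
    using tendsto_add[OF ergodic_average_tendsto ergodic_average_tendsto] ergodic_average_linear
    by (simp add: complex_linear_on_def)
next
  fix c x assume "x \<in> A"
  then show "(\<lambda>n. ergodic_average T n (c *\<^sub>C x)) \<longlonglongrightarrow> c *\<^sub>C ergodic_limit T x"
    using bounded_linear.tendsto[OF bounded_linear_scaleC ergodic_average_tendsto]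
      ergodic_average_linear
    by (simp add: complex_linear_on_def)
qed

lemma ergodic_limit_contractive: "x \<in> A \<Longrightarrow> norm (ergodic_limit T x) \<le> norm x"
  by (rule tendsto_upperbound[OF tendsto_norm[OF ergodic_average_tendsto]])
    (simp_all add: ergodic_average_contractive)

text \<open>The average and its image under \<open>T\<close> differ by \<open>(T\<^sup>n x - x) / n\<close>, since the sum telescopes.\<close>

lemma ergodic_limit_is_fixed:
  assumes x: "x \<in> A"
  shows "T (ergodic_limit T x) = ergodic_limit T x"
proof (rule LIMSEQ_unique)
  have gap: "T (ergodic_average T n x) - ergodic_average T n x = (1 / real n) *\<^sub>R ((T ^^ n) x - x)" for n
  proof -
    have "(\<Sum>k<n. T ((T ^^ k) x)) - (\<Sum>k<n. (T ^^ k) x) = (T ^^ n) x - x"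
      using sum_lessThan_telescope[of "\<lambda>k. (T ^^ k) x" n] by (simp add: sum_subtractf)
    moreover have "T (ergodic_average T n x) = (1 / real n) *\<^sub>R (\<Sum>k<n. T ((T ^^ k) x))"
      unfolding ergodic_average_def using x funpow_invariant
      by (subst complex_linear_on_scaleR[OF subspace linear])
        (auto intro: complex_subspace_sum[OF subspace] complex_linear_on_sum[OF subspace linear])
    ultimately show ?thesis by (simp only: ergodic_average_def flip: scaleR_diff_right)
  qed
  have "(\<lambda>n. T (ergodic_average T n x) - ergodic_average T n x) \<longlonglongrightarrow> 0"
  proof (rule Lim_null_comparison)
    show "\<forall>\<^sub>F n in sequentially.
        norm (T (ergodic_average T n x) - ergodic_average T n x) \<le> 2 * norm x / real n"
    proof (rule always_eventually, rule allI)
      fix n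
      have "norm ((T ^^ n) x - x) \<le> 2 * norm x"
        using norm_triangle_ineq4[of "(T ^^ n) x" x] funpow_contractive[OF x, of n] by simp
      then show "norm (T (ergodic_average T n x) - ergodic_average T n x) \<le> 2 * norm x / real n"
        by (simp add: gap divide_right_mono)
    qed
    show "(\<lambda>n. 2 * norm x / real n) \<longlonglongrightarrow> 0" by (rule lim_const_over_n)
  qed
  from tendsto_add[OF this ergodic_average_tendsto[OF x]]
  show "(\<lambda>n. T (ergodic_average T n x)) \<longlonglongrightarrow> ergodic_limit T x" by simp
  show "(\<lambda>n. T (ergodic_average T n x)) \<longlonglongrightarrow> T (ergodic_limit T x)"
    by (intro tendsto_apply ergodic_average_tendsto ergodic_average_invariant ergodic_limit_invariant x)
qed

end

end


section \<open>The expectation onto the fixed points of an automorphism\<close>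

text \<open>Ensures that the norm of an expectation fixing the identity is at least \<open>1\<close>.\<close>

lemma id_blinfun_neq_zero: "id_blinfun \<noteq> (0 :: 'a op)"
proof
  assume zero: "id_blinfun = (0 :: 'a op)"
  have "(\<Sum>g\<in>F. (cmod (if g = undefined then 1 else 0))\<^sup>2) \<le> 1\<^sup>2" if "finite F" for F :: "'a set"
    using that by (simp add: if_distrib[of cmod] if_distrib[of "\<lambda>r. r\<^sup>2"] cong: if_cong)
  then obtain x :: "'a ell2" where x: "Rep_ell2 x = (\<lambda>g. if g = undefined then 1 else 0)"
    by (rule ell2_of_bounded_sums) auto
  have "x = 0" using arg_cong[OF zero, of "\<lambda>S. blinfun_apply S x"] by simp
  then have "Rep_ell2 x undefined = 0" by (simp only: zero_ell2.rep_eq)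
  then show False by (simp add: x)
qed

text \<open>An automorphism preserves the identity because it is onto: if \<open>\<alpha>(e) = 1\<close> then
  \<open>\<alpha>(1) = \<alpha>(1) \<alpha>(e) = \<alpha>(e) = 1\<close>. This makes the theorem on unital *-homomorphisms applicable.\<close>

lemma star_automorphism_linear_contraction:
  assumes A: "cstar_algebra A" and id: "id_blinfun \<in> A" and \<alpha>: "star_automorphism A \<alpha>"
  shows "\<alpha> id_blinfun = id_blinfun" "linear_contraction A \<alpha>"
proof -
  have bij: "bij_betw \<alpha> A A" and linear: "complex_linear_on A \<alpha>"
    and mult: "\<And>S T. S \<in> A \<Longrightarrow> T \<in> A \<Longrightarrow> \<alpha> (S o\<^sub>L T) = \<alpha> S o\<^sub>L \<alpha> T"
    and star: "\<And>S T. S \<in> A \<Longrightarrow> T \<in> A \<Longrightarrow> is_adjoint S T \<Longrightarrow> is_adjoint (\<alpha> S) (\<alpha> T)"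
    using \<alpha> by (simp_all add: star_automorphism_def)
  have id_left: "id_blinfun o\<^sub>L S = S" and id_right: "S o\<^sub>L id_blinfun = S" for S :: "'a op"
    by (rule blinfun_eqI, simp)+
  obtain e where "e \<in> A" "\<alpha> e = id_blinfun"
    using bij id by (metis bij_betw_imp_surj_on imageE)
  then show unital: "\<alpha> id_blinfun = id_blinfun"
    using mult[OF id, of e] by (simp add: id_left id_right)
  show "linear_contraction A \<alpha>"
  proof
    show "closed A" using A by (simp add: cstar_algebra_def)
    show "\<alpha> x \<in> A" if "x \<in> A" for x using bij that by (auto simp: bij_betw_def)
    show "norm (\<alpha> x) \<le> norm x" if "x \<in> A" for x
      by (rule unital_star_homomorphism_contractive[OF A id linear mult star unital that])
  qed (rule cstar_algebra_subspace[OF A], rule linear)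
qed

text \<open>Closedness uses continuity of the automorphism, and closure under adjoints uses that adjoints
  are unique: \<open>\<alpha>(T)\<close> and \<open>T\<close> are both adjoint to \<open>\<alpha>(S) = S\<close>.\<close>

lemma cstar_algebra_fixed_points:
  assumes A: "cstar_algebra A" and id: "id_blinfun \<in> A" and \<alpha>: "star_automorphism A \<alpha>"
  shows "cstar_algebra (fixed_points A \<alpha>)"
proof -
  interpret linear_contraction A \<alpha> by (rule star_automorphism_linear_contraction[OF assms])
  show ?thesis
    unfolding cstar_algebra_def
  proof (intro conjI ballI allI)
    fix S assume "S \<in> fixed_points A \<alpha>"
    then have S: "S \<in> A" "\<alpha> S = S" by (simp_all add: fixed_points_def)
    show "complex_linear_on UNIV (blinfun_apply S)" using A S by (simp add: cstar_algebra_def)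
    show "c *\<^sub>C S \<in> fixed_points A \<alpha>" for c
      using subspace linear S by (simp add: fixed_points_def complex_subspace_def complex_linear_on_def)
    obtain T where T: "T \<in> A" "is_adjoint S T" using A S by (auto simp: cstar_algebra_def)
    then have "is_adjoint (\<alpha> S) (\<alpha> T)" using \<alpha> S(1) T(1) unfolding star_automorphism_def by metis
    then have "is_adjoint S (\<alpha> T)" by (simp only: S(2))
    then have "\<alpha> T = T" using T(2) by (rule is_adjoint_unique)
    with T show "\<exists>T\<in>fixed_points A \<alpha>. is_adjoint S T" by (auto simp: fixed_points_def)
  next
    fix S T assume "S \<in> fixed_points A \<alpha>" "T \<in> fixed_points A \<alpha>"
    then have ST: "S \<in> A" "\<alpha> S = S" "T \<in> A" "\<alpha> T = T" by (simp_all add: fixed_points_def)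
    show "S + T \<in> fixed_points A \<alpha>"
      using subspace linear ST by (simp add: fixed_points_def complex_subspace_def complex_linear_on_def)
    show "S o\<^sub>L T \<in> fixed_points A \<alpha>"
      using A \<alpha> ST by (simp add: fixed_points_def cstar_algebra_def star_automorphism_def)
  next
    show "0 \<in> fixed_points A \<alpha>"
      using subspace complex_linear_on_zero[OF subspace linear]
      by (simp add: fixed_points_def complex_subspace_def)
  next
    show "closed (fixed_points A \<alpha>)"
      unfolding closed_sequential_limits
    proof (intro allI impI)
      fix X x assume X: "(\<forall>n. X n \<in> fixed_points A \<alpha>) \<and> X \<longlonglongrightarrow> x"
      then have Xn: "X n \<in> A" "\<alpha> (X n) = X n" for n by (simp_all add: fixed_points_def)
      then have x: "x \<in> A" using closed X unfolding closed_sequential_limits by blast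
      have "X \<longlonglongrightarrow> \<alpha> x" using tendsto_apply[of X x] X Xn x by simp
      then have "\<alpha> x = x" using X LIMSEQ_unique by blast
      with x show "x \<in> fixed_points A \<alpha>" by (simp add: fixed_points_def)
    qed
  qed
qed

text \<open>The limit is contractive as a limit of contractions, its values are fixed by the telescoping
  argument, and it leaves fixed points alone, their averages being constant; the last two facts
  give idempotence and surjectivity onto the fixed-point algebra.\<close>

lemma conditional_expectation_ergodic_limit:
  assumes A: "cstar_algebra A" and id: "id_blinfun \<in> A" and \<alpha>: "star_automorphism A \<alpha>"
    and convergent: "\<And>x. x \<in> A \<Longrightarrow> convergent (\<lambda>n. ergodic_average \<alpha> n x)"
  shows "conditional_expectation A (fixed_points A \<alpha>) (ergodic_limit \<alpha>)"
proof -
  note unital = star_automorphism_linear_contraction(1)[OF A id \<alpha>]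
  interpret linear_contraction A \<alpha> by (rule star_automorphism_linear_contraction[OF A id \<alpha>])
  have range: "ergodic_limit \<alpha> x \<in> fixed_points A \<alpha>" if "x \<in> A" for x
    using that convergent
    by (simp add: fixed_points_def ergodic_limit_invariant ergodic_limit_is_fixed)
  have onto: "ergodic_limit \<alpha> x = x" if "x \<in> fixed_points A \<alpha>" for x
    using that by (simp add: fixed_points_def ergodic_limit_fixed_point)
  have "ergodic_limit \<alpha> ` A = fixed_points A \<alpha>"
  proof
    show "fixed_points A \<alpha> \<subseteq> ergodic_limit \<alpha> ` A"
    proof
      fix x assume "x \<in> fixed_points A \<alpha>"
      with onto[OF this] show "x \<in> ergodic_limit \<alpha> ` A" by (force simp: fixed_points_def)
    qed
  qed (auto intro: range)
  moreover have "has_norm_on A (ergodic_limit \<alpha>) 1"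
    unfolding has_norm_on_def
  proof (intro conjI ballI allI impI)
    fix K :: real assume "0 \<le> K" "\<forall>x\<in>A. norm (ergodic_limit \<alpha> x) \<le> K * norm x"
    then have "norm (id_blinfun :: 'a op) \<le> K * norm (id_blinfun :: 'a op)"
      using id ergodic_limit_fixed_point[OF unital] by metis
    moreover have "0 < norm (id_blinfun :: 'a op)" using id_blinfun_neq_zero by simp
    ultimately show "1 \<le> K" by simp
  qed (simp_all add: ergodic_limit_contractive convergent)
  ultimately show ?thesis
    unfolding conditional_expectation_def
    using A id cstar_algebra_fixed_points[OF A id \<alpha>] unital range onto
      ergodic_limit_linear[OF convergent]
    by (auto simp: fixed_points_def)
qed


section \<open>The reduced group C*-algebra\<close>

lemma left_regular_zero: "left_regular 0 = id_blinfun"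
proof (rule blinfun_eqI)
  fix x :: "'a ell2"
  show "blinfun_apply (left_regular 0) x = blinfun_apply id_blinfun x"
    by (rule Rep_ell2_inject[THEN iffD1]) (simp add: fun_eq_iff left_regular.rep_eq left_shift.rep_eq)
qed

lemma left_regular_add: "left_regular g o\<^sub>L left_regular h = left_regular (g + h)"
proof (rule blinfun_eqI)
  fix x :: "'a ell2"
  show "blinfun_apply (left_regular g o\<^sub>L left_regular h) x = blinfun_apply (left_regular (g + h)) x"
    by (rule Rep_ell2_inject[THEN iffD1])
      (simp add: fun_eq_iff left_regular.rep_eq left_shift.rep_eq minus_add add.assoc
        flip: add_uminus_conv_diff)
qed

lemma left_regular_complex_linear: "complex_linear_on UNIV (blinfun_apply (left_regular g))"
proof -
  have "left_shift g (c *\<^sub>C x) = c *\<^sub>C left_shift g x" for c x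
    by (rule Rep_ell2_inject[THEN iffD1])
      (simp add: fun_eq_iff left_shift.rep_eq scaleC_ell2.rep_eq)
  then show ?thesis
    unfolding complex_linear_on_def by (simp only: blinfun.add_right) (simp add: left_regular.rep_eq)
qed

lemma left_regular_adjoint: "is_adjoint (left_regular g) (left_regular (- g))"
  unfolding is_adjoint_def
proof (intro allI)
  fix x y :: "'a ell2"
  have "blinfun_apply (left_regular g) (blinfun_apply (left_regular (- g)) y) = y"
    using arg_cong[OF left_regular_add[of g "- g"], of "\<lambda>S. blinfun_apply S y"]
    by (simp add: left_regular_zero)
  then show "cinner (blinfun_apply (left_regular g) x) y
      = cinner x (blinfun_apply (left_regular (- g)) y)"
    using cinner_left_shift[of g x "blinfun_apply (left_regular (- g)) y"]
    by (simp add: left_regular.rep_eq)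
qed

text \<open>The complex group algebra, as the linear span of the left translations. The inductive form lets
  products and adjoints be treated generator by generator, with no bookkeeping of coefficients.\<close>

inductive_set group_ring :: "'g::group_add op set" where
  generator: "left_regular g \<in> group_ring"
| add: "S \<in> group_ring \<Longrightarrow> T \<in> group_ring \<Longrightarrow> S + T \<in> group_ring"
| scale: "S \<in> group_ring \<Longrightarrow> c *\<^sub>C S \<in> group_ring"

lemma group_ring_subset:
  fixes N :: "'g::group_add op set"
  assumes "complex_subspace N" "range left_regular \<subseteq> N"
  shows "group_ring \<subseteq> N"
proof
  fix S :: "'g op" assume "S \<in> group_ring"
  then show "S \<in> N" using assms by induction (auto simp: complex_subspace_def)
qed

lemma complex_subspace_group_ring: "complex_subspace group_ring"
  using group_ring.scale[OF group_ring.generator[of 0], of 0]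
  by (simp add: complex_subspace_def group_ring.add group_ring.scale)

lemma group_ring_complex_linear:
  "S \<in> group_ring \<Longrightarrow> complex_linear_on UNIV (blinfun_apply S)"
proof (induction rule: group_ring.induct)
  case (generator g)
  show ?case by (rule left_regular_complex_linear)
next
  case (add S T)
  then show ?case
    by (simp add: complex_linear_on_def blinfun.bilinear_simps scaleC_add_right)
next
  case (scale S c)
  then show ?case
    by (simp add: complex_linear_on_def scaleC_blinfun.rep_eq scaleC_add_right scaleC_scaleC mult.commute)
qed

lemma group_ring_compose:
  assumes "S \<in> group_ring" "T \<in> group_ring"
  shows "S o\<^sub>L T \<in> group_ring"
  using assms
proof (induction S rule: group_ring.induct)
  case (generator g)
  show ?case
    using generator
  proof (induction T rule: group_ring.induct)
    case (generator h)
    show ?case by (simp add: left_regular_add group_ring.generator)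
  next
    case (add S T)
    have "left_regular g o\<^sub>L (S + T) = (left_regular g o\<^sub>L S) + (left_regular g o\<^sub>L T)"
      by (rule blinfun_eqI) (simp add: blinfun.bilinear_simps)
    with add show ?case by (simp add: group_ring.add)
  next
    case (scale S c)
    have "left_regular g o\<^sub>L (c *\<^sub>C S) = c *\<^sub>C (left_regular g o\<^sub>L S)"
      using left_regular_complex_linear[of g]
      by (intro blinfun_eqI) (simp add: scaleC_blinfun.rep_eq complex_linear_on_def)
    with scale show ?case by (simp add: group_ring.scale)
  qed
next
  case (add S S')
  have "(S + S') o\<^sub>L T = (S o\<^sub>L T) + (S' o\<^sub>L T)"
    by (rule blinfun_eqI) (simp add: blinfun.bilinear_simps)
  with add show ?case by (simp add: group_ring.add)
next
  case (scale S c)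
  have "(c *\<^sub>C S) o\<^sub>L T = c *\<^sub>C (S o\<^sub>L T)"
    by (rule blinfun_eqI) (simp add: scaleC_blinfun.rep_eq)
  with scale show ?case by (simp add: group_ring.scale)
qed

lemma group_ring_adjoint: "S \<in> group_ring \<Longrightarrow> \<exists>T\<in>group_ring. is_adjoint S T"
proof (induction rule: group_ring.induct)
  case (generator g)
  show ?case using left_regular_adjoint group_ring.generator by blast
next
  case (add S T)
  then show ?case using is_adjoint_add group_ring.add by blast
next
  case (scale S c)
  then show ?case using is_adjoint_scaleC group_ring.scale by blast
qed

lemma cstar_algebra_closure_group_ring: "cstar_algebra (closure group_ring)"
  by (intro cstar_algebra_closure group_ring_complex_linear complex_subspace_group_ring
      group_ring_compose group_ring_adjoint)

lemma reduced_group_cstar_eq_closure: "reduced_group_cstar = closure group_ring"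
proof
  have "range left_regular \<subseteq> closure group_ring"
    using group_ring.generator closure_subset by blast
  then show "reduced_group_cstar \<subseteq> closure group_ring"
    using cstar_algebra_closure_group_ring by (auto simp: reduced_group_cstar_def)
  show "closure group_ring \<subseteq> reduced_group_cstar"
    unfolding reduced_group_cstar_def
  proof (intro Inter_greatest closure_minimal)
    fix A assume "A \<in> {A. cstar_algebra A \<and> range left_regular \<subseteq> A}"
    then show "group_ring \<subseteq> A" "closed A"
      using group_ring_subset cstar_algebra_subspace by (auto simp: cstar_algebra_def)
  qed
qed

lemma cstar_algebra_reduced_group_cstar: "cstar_algebra reduced_group_cstar"
  by (simp add: reduced_group_cstar_eq_closure cstar_algebra_closure_group_ring)

lemma left_regular_in_reduced_group_cstar: "left_regular g \<in> reduced_group_cstar"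
  by (auto simp: reduced_group_cstar_def)

text \<open>The linear span of the \<open>\<lambda>(g)\<close> is already closed under products and adjoints, so a property that
  defines a closed linear subspace, without any multiplicative structure, extends from the \<open>\<lambda>(g)\<close>.\<close>

lemma reduced_group_cstar_subset:
  fixes N :: "'g::group_add op set"
  assumes "complex_subspace N" "closed N" "\<And>g. left_regular g \<in> N"
  shows "reduced_group_cstar \<subseteq> N"
  unfolding reduced_group_cstar_eq_closure
  using assms by (intro closure_minimal group_ring_subset) auto


section \<open>Rapid decay along infinite orbits\<close>

text \<open>A repetition \<open>\<beta>\<^sup>i(g) = \<beta>\<^sup>j(g)\<close> makes \<open>g\<close> periodic, by injectivity, and then the forward and the
  backward orbit both have at most \<open>\<bar>j - i\<bar>\<close> elements.\<close>

lemma infinite_orbit_inj: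
  assumes "bij \<beta>" "infinite (aut_orbit \<beta> g)"
  shows "inj (\<lambda>k. (\<beta> ^^ k) g)"
proof (rule ccontr)
  assume "\<not> inj (\<lambda>k. (\<beta> ^^ k) g)"
  then obtain i j where ij: "i < j" "(\<beta> ^^ i) g = (\<beta> ^^ j) g"
    unfolding inj_def by (metis linorder_neqE_nat)
  define p where "p = j - i"
  have p: "0 < p" using ij by (simp add: p_def)
  have "(\<beta> ^^ i) ((\<beta> ^^ p) g) = (\<beta> ^^ i) g"
    using ij by (simp add: p_def flip: funpow_add comp_apply[of "\<beta> ^^ i"])
  moreover have "inj (\<beta> ^^ i)" using assms(1) by (intro inj_fn bij_is_inj)
  ultimately have forward: "(\<beta> ^^ p) g = g" by (simp add: inj_eq)
  then have backward: "(inv \<beta> ^^ p) g = g"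
    by (metis assms(1) bij_fn bij_is_inj inv_f_f inv_fn)
  have range: "range (\<lambda>n. (f ^^ n) g) \<subseteq> (\<lambda>n. (f ^^ n) g) ` {..<p}" if "(f ^^ p) g = g" for f
  proof
    fix y assume "y \<in> range (\<lambda>n. (f ^^ n) g)"
    then obtain n where "y = (f ^^ n) g" by blast
    then have "y = (f ^^ (n mod p)) g" using funpow_mod_eq[OF that, of n] by simp
    with p show "y \<in> (\<lambda>n. (f ^^ n) g) ` {..<p}" by simp
  qed
  have "finite (aut_orbit \<beta> g)"
    unfolding aut_orbit_def
    using range[OF forward] range[OF backward] by (meson finite_UnI finite_imageI finite_lessThan finite_subset)
  with assms(2) show False by simp
qed

lemma singleton_orbit_fixed:
  assumes "is_singleton (aut_orbit \<beta> g)"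
  shows "\<beta> g = g"
proof -
  have "(\<beta> ^^ 1) g \<in> aut_orbit \<beta> g" "(\<beta> ^^ 0) g \<in> aut_orbit \<beta> g"
    unfolding aut_orbit_def by blast+
  with assms show ?thesis by (auto simp: is_singleton_def)
qed

text \<open>Square-root cancellation along the forward orbit, uniform in the phases.\<close>

definition orbit_decay :: "('g::group_add \<Rightarrow> 'g) \<Rightarrow> 'g \<Rightarrow> real \<Rightarrow> bool" where
  "orbit_decay \<beta> g K \<longleftrightarrow> (\<forall>n c. (\<forall>k. cmod (c k) = 1) \<longrightarrow>
     norm (\<Sum>k<n. c k *\<^sub>C left_regular ((\<beta> ^^ k) g)) \<le> K * sqrt (real n))"

text \<open>The weight \<open>(1 + L)\<^bsup>2s\<^esup>\<close> is constant along the orbit, hence comes out of the sum of squares as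
  a factor, and \<open>n\<close> distinct group elements with coefficients of modulus one leave exactly \<open>n\<close>.
  Distinctness is essential: for a fixed \<open>g\<close> the sum with all phases equal has norm \<open>n\<close>.\<close>

lemma RD_group_orbit_decay:
  fixes L :: "'g::group_add \<Rightarrow> real"
  assumes "RD_group L" and preserves: "\<And>g. L (\<beta> g) = L g"
    and inj: "inj (\<lambda>k. (\<beta> ^^ k) g)"
  shows "\<exists>K. orbit_decay \<beta> g K"
proof -
  obtain C s where RD: "\<And>f :: 'g \<Rightarrow> complex. finite {g. f g \<noteq> 0} \<Longrightarrow>
      norm (\<Sum>g | f g \<noteq> 0. f g *\<^sub>C left_regular g)
        \<le> C * sqrt (\<Sum>g | f g \<noteq> 0. (cmod (f g))\<^sup>2 * (1 + L g) powr (2 * s))"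
    using assms(1) unfolding RD_group_def by blast
  define p where "p k = (\<beta> ^^ k) g" for k
  have L: "L (p k) = L g" for k unfolding p_def by (induction k) (simp_all add: preserves)
  have inj: "inj p" using inj by (simp add: p_def[abs_def])
  have "orbit_decay \<beta> g (C * sqrt ((1 + L g) powr (2 * s)))"
    unfolding orbit_decay_def
  proof (intro allI impI)
    fix n and c :: "nat \<Rightarrow> complex" assume "\<forall>k. cmod (c k) = 1"
    then have c: "cmod (c k) = 1" for k by blast
    \<comment> \<open>The coefficients \<open>c\<close> transported to the group, as rapid decay sums over group elements.\<close>
    define f where "f h = (if h \<in> p ` {..<n} then c (inv p h) else 0)" for h
    have "c k \<noteq> 0" for k using c[of k] by auto
    then have supp: "{h. f h \<noteq> 0} = p ` {..<n}" by (auto simp: f_def)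
    have fp: "f (p k) = c k" if "k < n" for k using that inj by (simp add: f_def)
    have reindex: "sum F (p ` {..<n}) = (\<Sum>k<n. F (p k))" for F :: "'g \<Rightarrow> 'b::comm_monoid_add"
      using inj by (subst sum.reindex) (auto intro: inj_on_subset)
    have "norm (\<Sum>k<n. c k *\<^sub>C left_regular (p k)) = norm (\<Sum>h | f h \<noteq> 0. f h *\<^sub>C left_regular h)"
      by (simp add: supp reindex fp)
    also have "\<dots> \<le> C * sqrt (\<Sum>h | f h \<noteq> 0. (cmod (f h))\<^sup>2 * (1 + L h) powr (2 * s))"
      by (rule RD) (simp add: supp)
    also have "(\<Sum>h | f h \<noteq> 0. (cmod (f h))\<^sup>2 * (1 + L h) powr (2 * s))
        = real n * (1 + L g) powr (2 * s)"
      by (simp add: supp reindex fp c L)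
    finally show "norm (\<Sum>k<n. c k *\<^sub>C left_regular ((\<beta> ^^ k) g))
        \<le> (C * sqrt ((1 + L g) powr (2 * s))) * sqrt (real n)"
      by (simp add: p_def real_sqrt_mult mult.commute mult.left_commute)
  qed
  then show ?thesis by blast
qed

text \<open>Rotating each term by the conjugate phase of its value turns the sum of absolute values into the
  value of \<open>\<phi>\<close> at a single element, to which the norm bound applies.\<close>

lemma orbit_decay_functional:
  fixes \<phi> :: "'g::group_add op \<Rightarrow> complex"
  assumes "orbit_decay \<beta> g K"
    and linear: "complex_linear_on reduced_group_cstar \<phi>"
    and bound: "\<And>y. y \<in> reduced_group_cstar \<Longrightarrow> cmod (\<phi> y) \<le> norm y"
  shows "(\<Sum>k<n. cmod (\<phi> (left_regular ((\<beta> ^^ k) g)))) \<le> K * sqrt (real n)"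
proof -
  define z where "z k = \<phi> (left_regular ((\<beta> ^^ k) g))" for k
  \<comment> \<open>Where the value vanishes any phase would do; the modulus must still be one.\<close>
  define c where "c k = (if z k = 0 then 1 else cnj (sgn (z k)))" for k
  have c: "cmod (c k) = 1" for k by (simp add: c_def norm_sgn)
  have cz: "c k * z k = complex_of_real (cmod (z k))" for k
  proof (cases "z k = 0")
    case False
    have "cnj (z k) * z k = complex_of_real (cmod (z k)) * complex_of_real (cmod (z k))"
      using complex_norm_square[of "z k"] by (simp add: power2_eq_square mult.commute)
    with False show ?thesis by (simp add: c_def sgn_eq field_simps)
  qed simp
  have subspace: "complex_subspace (reduced_group_cstar :: 'g op set)"
    by (rule cstar_algebra_subspace[OF cstar_algebra_reduced_group_cstar])
  define y where "y = (\<Sum>k<n. c k *\<^sub>C left_regular ((\<beta> ^^ k) g))"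
  have terms: "c k *\<^sub>C left_regular ((\<beta> ^^ k) g) \<in> reduced_group_cstar" for k
    using subspace by (simp add: complex_subspace_def left_regular_in_reduced_group_cstar)
  have "\<phi> y = (\<Sum>k<n. \<phi> (c k *\<^sub>C left_regular ((\<beta> ^^ k) g)))"
    unfolding y_def by (rule complex_linear_on_sum[OF subspace linear terms])
  also have "\<dots> = (\<Sum>k<n. c k * z k)"
    using linear
    by (simp add: complex_linear_on_def scaleC_complex_def z_def left_regular_in_reduced_group_cstar)
  also have "\<dots> = complex_of_real (\<Sum>k<n. cmod (z k))"
    by (simp add: cz)
  finally have "(\<Sum>k<n. cmod (z k)) = cmod (\<phi> y)"
    by (simp only: norm_of_real) (simp add: sum_nonneg)
  also have "\<dots> \<le> norm y"
    unfolding y_def by (intro bound complex_subspace_sum[OF subspace] terms)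
  also have "\<dots> \<le> K * sqrt (real n)"
    using assms(1) c unfolding y_def orbit_decay_def by blast
  finally show ?thesis by (simp only: z_def)
qed

lemma cesaro_null_of_sqrt_bound:
  fixes a :: "nat \<Rightarrow> real"
  assumes "\<And>n. 0 \<le> a n" "\<And>n. a n \<le> K * sqrt (real n)"
  shows "(\<lambda>n. (1 / real n) * a n) \<longlonglongrightarrow> 0"
proof (rule tendsto_sandwich[of "\<lambda>_. 0"])
  have "(1 / real n) * a n \<le> K / sqrt (real n)" for n
  proof (cases "n = 0")
    case False
    have "(1 / real n) * a n \<le> (1 / real n) * (K * sqrt (real n))"
      by (intro mult_left_mono assms) simp
    also have "\<dots> = K / sqrt (real n)"
      using False by (simp add: field_simps flip: real_sqrt_mult)
    finally show ?thesis .
  qed simp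
  then show "\<forall>\<^sub>F n in sequentially. (1 / real n) * a n \<le> K / sqrt (real n)" by simp
  show "(\<lambda>n. K / sqrt (real n)) \<longlonglongrightarrow> 0"
    by (intro tendsto_divide_0[OF tendsto_const] filterlim_at_top_imp_at_infinity
        filterlim_compose[OF sqrt_at_top] filterlim_real_sequentially)
qed (simp_all add: assms)


section \<open>Strict weak mixing\<close>

theorem proposition3p1:
  fixes L :: "'g::group_add \<Rightarrow> real"
    and \<beta> :: "'g \<Rightarrow> 'g"
    and \<alpha> :: "'g op \<Rightarrow> 'g op"
  assumes "RD_group L"
    and "group_automorphism \<beta>"
    and "\<And>g. L (\<beta> g) = L g"
    and "\<And>g. infinite (aut_orbit \<beta> g) \<or> is_singleton (aut_orbit \<beta> g)"
    and "induced_automorphism \<beta> \<alpha>"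
  shows "\<exists>E. conditional_expectation reduced_group_cstar (fixed_points reduced_group_cstar \<alpha>) E \<and>
             strictly_weak_mixing reduced_group_cstar E \<alpha>"
proof (intro exI conjI)
  have star: "star_automorphism reduced_group_cstar \<alpha>"
    and gen: "\<And>g. \<alpha> (left_regular g) = left_regular (\<beta> g)"
    using assms(5) by (simp_all add: induced_automorphism_def)
  have bij: "bij \<beta>" using assms(2) by (simp add: group_automorphism_def)
  note A = cstar_algebra_reduced_group_cstar and regular = left_regular_in_reduced_group_cstar
  have id: "id_blinfun \<in> (reduced_group_cstar :: 'g op set)"
    using regular[of 0] by (simp add: left_regular_zero)
  interpret linear_contraction reduced_group_cstar \<alpha>
    by (rule star_automorphism_linear_contraction[OF A id star])
  have power: "(\<alpha> ^^ k) (left_regular g) = left_regular ((\<beta> ^^ k) g)" for k g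
    by (induction k) (simp_all add: gen)
  have dichotomy: "\<beta> g = g \<or> (\<exists>K. orbit_decay \<beta> g K)" for g
    using assms(4)[of g]
  proof
    assume "infinite (aut_orbit \<beta> g)"
    with RD_group_orbit_decay[OF assms(1,3) infinite_orbit_inj[OF bij]] show ?thesis by blast
  qed (simp add: singleton_orbit_fixed)
  have average_null: "(\<lambda>n. ergodic_average \<alpha> n (left_regular g)) \<longlonglongrightarrow> 0" if K: "orbit_decay \<beta> g K" for g K
  proof (rule tendsto_norm_zero_cancel)
    have "norm (\<Sum>k<n. left_regular ((\<beta> ^^ k) g)) \<le> K * sqrt (real n)" for n
      using K[unfolded orbit_decay_def, rule_format, of "\<lambda>_. 1" n] by simp
    from cesaro_null_of_sqrt_bound[OF norm_ge_zero this]
    show "(\<lambda>n. norm (ergodic_average \<alpha> n (left_regular g))) \<longlonglongrightarrow> 0"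
      by (simp add: ergodic_average_def power)
  qed
  have "left_regular g \<in> {x \<in> reduced_group_cstar. convergent (\<lambda>n. ergodic_average \<alpha> n x)}" for g
  proof -
    have "convergent (\<lambda>n. ergodic_average \<alpha> n (left_regular g))"
      using dichotomy[of g]
    proof
      assume "\<beta> g = g"
      then have "\<alpha> (left_regular g) = left_regular g" by (simp add: gen)
      from ergodic_average_tendsto_fixed_point[OF this] show ?thesis by (rule convergentI)
    next
      assume "\<exists>K. orbit_decay \<beta> g K"
      then obtain K where "orbit_decay \<beta> g K" ..
      from average_null[OF this] show ?thesis by (rule convergentI)
    qed
    with regular show ?thesis by blast
  qed
  then have "reduced_group_cstar \<subseteq>
      {x \<in> reduced_group_cstar. convergent (\<lambda>n. ergodic_average \<alpha> n x)}"
    by (intro reduced_group_cstar_subset averages_converge_subspace)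
  then have convergent: "convergent (\<lambda>n. ergodic_average \<alpha> n x)" if "x \<in> reduced_group_cstar" for x
    using that by blast
  show "conditional_expectation reduced_group_cstar (fixed_points reduced_group_cstar \<alpha>) (ergodic_limit \<alpha>)"
    by (rule conditional_expectation_ergodic_limit[OF A id star convergent])
  show "strictly_weak_mixing reduced_group_cstar (ergodic_limit \<alpha>) \<alpha>"
    unfolding strictly_weak_mixing_def
  proof (intro ballI allI impI)
    fix x :: "'g op" and \<phi> :: "'g op \<Rightarrow> complex"
    assume x: "x \<in> reduced_group_cstar" and "state_on reduced_group_cstar \<phi>"
    then have \<phi>: "complex_linear_on reduced_group_cstar \<phi>"
      and \<phi>_le: "\<And>y. y \<in> reduced_group_cstar \<Longrightarrow> cmod (\<phi> y) \<le> norm y"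
      by (simp_all add: state_on_def has_norm_on_def)
    \<comment> \<open>The deviations are linear in the element, so that their strong averages vanish on a closed subspace.\<close>
    define u where "u k y = \<phi> ((\<alpha> ^^ k) y) - \<phi> (ergodic_limit \<alpha> y)" for k y
    have u_linear: "complex_linear_on reduced_group_cstar (u k)" for k
      using \<phi> funpow_linear[of k] ergodic_limit_linear[OF convergent] funpow_invariant[of _ k]
        ergodic_limit_invariant[OF convergent]
      by (simp add: complex_linear_on_def u_def scaleC_complex_def algebra_simps)
    have u_bound: "cmod (u k y) \<le> 2 * norm y" if "y \<in> reduced_group_cstar" for k y
      using norm_triangle_ineq4[of "\<phi> ((\<alpha> ^^ k) y)" "\<phi> (ergodic_limit \<alpha> y)"]
        \<phi>_le[OF funpow_invariant[OF that, of k]] \<phi>_le[OF ergodic_limit_invariant[OF convergent that]]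
        funpow_contractive[OF that, of k] ergodic_limit_contractive[OF convergent that]
      by (simp add: u_def)
    have "(\<lambda>n. (1 / real n) * (\<Sum>k<n. cmod (u k (left_regular g)))) \<longlonglongrightarrow> 0" for g
      using dichotomy[of g]
    proof
      assume "\<beta> g = g"
      then have fixed: "\<alpha> (left_regular g) = left_regular g" by (simp add: gen)
      then have "(\<alpha> ^^ k) (left_regular g) = left_regular g" for k by (induction k) simp_all
      then show ?thesis by (simp add: u_def ergodic_limit_fixed_point[OF fixed])
    next
      assume "\<exists>K. orbit_decay \<beta> g K"
      then obtain K where K: "orbit_decay \<beta> g K" ..
      have "u k (left_regular g) = \<phi> (left_regular ((\<beta> ^^ k) g))" for k
        using ergodic_limit_eqI[OF average_null[OF K]] complex_linear_on_zero[OF subspace \<phi>]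
        by (simp add: u_def power)
      then show ?thesis
        using orbit_decay_functional[OF K \<phi> \<phi>_le]
        by (intro cesaro_null_of_sqrt_bound) (simp_all add: sum_nonneg)
    qed
    then have "reduced_group_cstar \<subseteq> {y \<in> reduced_group_cstar.
        (\<lambda>n. (1 / real n) * (\<Sum>k<n. cmod (u k y))) \<longlonglongrightarrow> 0}"
      by (intro reduced_group_cstar_subset cesaro_null_subspace[OF subspace closed u_linear u_bound])
        (simp_all add: regular)
    with x show "(\<lambda>n. (1 / real n) * (\<Sum>k<n. cmod (\<phi> ((\<alpha> ^^ k) x) - \<phi> (ergodic_limit \<alpha> x)))) \<longlonglongrightarrow> 0"
      by (auto simp: u_def)
  qed
qed

end
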